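(* Let $\boldsymbol V_h\times Q_h$ be the surface Scott–Vogelius pair of degree $r\ge 2$ on the curved Clough–Tocher triangulation $\mathcal T_h^{\rm ct}$ of $\Gamma_h$. If $\boldsymbol v\in \boldsymbol V_h$ satisfies $$\int_{\Gamma_h}({\rm div}_{\Gamma_h}\boldsymbol v)\,q=0\qquad \forall q\in Q_h,$$ then ${\rm div}_{\Gamma_h}\boldsymbol v\equiv 0$ on $\Gamma_h$.
   Context: **Exact surface.** $\gamma\subset\mathbb R^3$ is a smooth, closed, orientable two-dimensional surface with outward unit normal $\boldsymbol\nu$; $d$ is its signed distance function in a tubular neighborhood $U_\delta$, $\boldsymbol\nu=\nabla d$, and $\boldsymbol p(x)=x-d(x)\boldsymbol\nu(x)$ is the closest point projection $U_\delta\to\gamma$. $a\lesssim b$ means $a\le Cb$ with $C$ independent of the mesh size, $a\approx b$ means $a\lesssim b\lesssim a$; $\mathcal O(h^m)$ denotes a quantity bounded by $Ch^m$, $C$ independent of $h$. **Affine meshes.** $\bar\Gamma_h\subset U_\delta$ is a closed polyhedral surface, the union of flat triangular faces $\bar{\mathcal T}_h$ (shape regular), with $h_{\bar T}={\rm diam}(\bar T)$, $h=\max h_{\bar T}$ and $d=\mathcal O(h^2)$ on $\bar\Gamma_h$. $\hat T$ is the reference triangle with vertices $(1,0),(0,1),(0,0)$. $\bar{\mathcal T}_h^{\rm ct}$ is the Clough–Tocher refinement of $\bar{\mathcal T}_h$: each $\bar T$ is split into three triangles by connecting its vertices to its barycenter. For $\bar K\in\bar{\mathcal T}_h^{\rm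 ct}$, $F_{\bar K}:\hat T\to\bar K$ is an affine diffeomorphism with $\|\nabla F_{\bar K}\|_{L^\infty}\lesssim h_{\bar K}$, $\det(\nabla F_{\bar K}^\intercal\nabla F_{\bar K})\approx h_{\bar K}^4$, $h_{\bar K}={\rm diam}(\bar K)$. **High-order surface.** $k\in\mathbb N$; $\boldsymbol\Psi_{\rm ct}:\bar\Gamma_h\to\Gamma_h$ is a continuous bijection with $\boldsymbol\Psi_{\rm ct}|_{\bar K}\in[\mathbb P_k(\bar K)]^3$ for all $\bar K\in\bar{\mathcal T}_h^{\rm ct}$, and $|\boldsymbol p-\boldsymbol\Psi_{\rm ct}|=\mathcal O(h^{k+1})$, $|\nabla\boldsymbol p-\nabla\boldsymbol\Psi_{\rm ct}|=\mathcal O(h^k)$ on $\bar\Gamma_h$. $\mathcal T_h^{\rm ct}=\{\boldsymbol\Psi_{\rm ct}(\bar K):\bar K\in\bar{\mathcal T}_h^{\rm ct}\}$. For $K=\boldsymbol\Psi_{\rm ct}(\bar K)$, $F_K=\boldsymbol\Psi_{\rm ct}\circ F_{\bar K}:\hat T\to K$ is a degree-$k$ polynomial diffeomorphism, $h_K=h_{\bar K}$, and for $1\le m\le k+1$: $|F_K|_{W^{m,\infty}(\hat T)}\lesssim h_K^m$, $|F_K^{-1}|_{W^{m,\infty}(K)}\lesssim h_K^{-1}$, $\det(\nabla F_K^\intercal\nabla F_K)\approx h_K^4$. $\boldsymbol\nu_h$ is the outward unit normal of $\Gamma_h$ and $\boldsymbol\nu_K=\boldsymbol\nu_h|_K$.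 ${\rm div}_{\Gamma_h}$ is the (elementwise) surface divergence. **Local spaces.** For a diffeomorphism $F:\hat T\to K$, the Piola transform is $\mathcal P_F\hat{\boldsymbol v}=(J_F^{-1}\nabla F\,\hat{\boldsymbol v})\circ F^{-1}$, $J_F=\sqrt{\det(\nabla F^\intercal\nabla F)}$. For $r\ge2$: $\boldsymbol V(K)=\{\mathcal P_{F_K}\hat{\boldsymbol v}:\hat{\boldsymbol v}\in\mathbb P_r(\hat T)^2\}$, $Q(K)=\{\hat q\circ F_K^{-1}:\hat q\in\mathbb P_{r-1}(\hat T)\}$. **Nodes.** $\bar{\mathcal N}_h^{\rm ct}$ is the set of degree-$r$ Lagrange nodes of $\bar{\mathcal T}_h^{\rm ct}$, the nodes on edges being the $(r+1)$-point Gauss–Lobatto nodes (standing assumption); $\mathcal N_h^{\rm ct}=\{\boldsymbol\Psi_{\rm ct}(\bar a):\bar a\in\bar{\mathcal N}_h^{\rm ct}\}$. $\mathcal T_a^{\rm ct}$ is the set of elements of $\mathcal T_h^{\rm ct}$ abutting $a$. For each $a\in\mathcal N_h^{\rm ct}$ one fixed $K_a\in\mathcal T_a^{\rm ct}$ is chosen arbitrarily, and for $K\in\mathcal T_a^{\rm ct}$, $\mathcal M_a^K\boldsymbol x=\big((\boldsymbol\nu_{K_a}(a)\cdot\boldsymbol\nu_K(a))\mathbf I_3-\boldsymbol\nu_{K_a}(a)\otimes\boldsymbol\nu_K(a)\big)\boldsymbol x$. **Global spaces.** $\boldsymbol V_h=\{\boldsymbol v\in\boldsymbol L^2(\Gamma_h):\boldsymbol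 v|_K\in\boldsymbol V(K)\ \forall K\in\mathcal T_h^{\rm ct};\ \boldsymbol v|_K(a)=\mathcal M_a^K\boldsymbol v|_{K_a}(a)\ \forall a\in\mathcal N_h^{\rm ct},\ \forall K\in\mathcal T_a^{\rm ct}\}$ and $Q_h=\{q\in L^2_0(\Gamma_h):q|_K\in Q(K)\ \forall K\in\mathcal T_h^{\rm ct}\}$, where $L_0^2$ denotes square-integrable functions with zero mean. It is known that $\boldsymbol V_h\subset\boldsymbol H({\rm div}_{\Gamma_h};\Gamma_h)$ (co-normal continuity across edges). *)

theory Defs
  imports "HOL-Analysis.Analysis" "HOL-Computational_Algebra.Polynomial"
begin

text \<open>
  Conventions. A single constant \<open>C\<close> serves in all relations \<open>\<lesssim>\<close>, \<open>\<approx>\<close> and all \<open>O(h^m)\<close>. It is a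
  parameter that is fixed before the mesh, so it is independent of the mesh size.

  Elements \<open>K = \<Psi> ` Kb\<close> of the curved mesh are indexed by their affine counterparts \<open>Kb\<close>
  (\<open>\<Psi>\<close> is injective). A function on \<open>\<Gamma>\<^sub>h\<close> that is only elementwise regular is the family
  \<open>Kb \<mapsto> v Kb\<close> of its restrictions to the closed elements: edges carry no surface measure, and
  on an edge or at a node the values taken from different elements may differ.
  Only the values of \<open>v Kb\<close> on \<open>\<Psi> ` Kb\<close> matter.

  Derivatives on an element are taken \<open>at x within\<close> the element. On a flat or curved
  triangle in space such a derivative is uniquely determined on the tangent plane, also at edges and
  vertices, and not in the normal direction; it is only ever applied to tangent vectors.
\<close>

section \<open>Smooth functions and polynomials\<close>

text \<open>\<open>n\<close> times continuously differentiable, for open \<open>S\<close>.\<close>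

fun C_on :: "nat \<Rightarrow> 'a set \<Rightarrow> ('a::euclidean_space \<Rightarrow> 'b::real_normed_vector) \<Rightarrow> bool" where
  "C_on 0 S f = continuous_on S f"
| "C_on (Suc n) S f =
     (f differentiable_on S \<and> (\<forall>b\<in>Basis. C_on n S (\<lambda>x. frechet_derivative f (at x) b)))"

definition smooth_on :: "'a set \<Rightarrow> ('a::euclidean_space \<Rightarrow> 'b::real_normed_vector) \<Rightarrow> bool" where
  "smooth_on S f \<longleftrightarrow> (\<forall>n. C_on n S f)"

definition grad :: "('a::euclidean_space \<Rightarrow> real) \<Rightarrow> 'a \<Rightarrow> 'a" where
  "grad f x = (\<Sum>b\<in>Basis. frechet_derivative f (at x) b *\<^sub>R b)"

text \<open>Polynomials of total degree at most \<open>m\<close>; \<open>e\<close> runs over the multi-indices.\<close>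

definition poly_le :: "nat \<Rightarrow> (real^'n \<Rightarrow> real) set" where
  "poly_le m = {p. \<exists>c. p = (\<lambda>x. \<Sum>e | (\<Sum>i\<in>UNIV. e i) \<le> m. c e * (\<Prod>i\<in>UNIV. (x $ i) ^ e i))}"

lemma finite_multi_indices: "finite {e :: 'n::finite \<Rightarrow> nat. (\<Sum>i\<in>UNIV. e i) \<le> m}"
proof (rule finite_subset)
  show "{e :: 'n \<Rightarrow> nat. (\<Sum>i\<in>UNIV. e i) \<le> m} \<subseteq> UNIV \<rightarrow>\<^sub>E {..m}"
    by (auto simp: PiE_def Pi_def extensional_def)
       (metis UNIV_I finite le_trans member_le_sum zero_le)
qed (auto intro: finite_PiE)

text \<open>
  Iterated directional derivatives within \<open>S\<close>. At \<open>x\<close> the direction \<open>w\<close> is replaced by \<open>P x w\<close>: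
  for a surface, \<open>P\<close> is the projection onto the tangent plane, which gives the components of the
  iterated surface gradient.
\<close>

fun dir_derivs :: "'a set \<Rightarrow> ('a \<Rightarrow> 'a \<Rightarrow> 'a) \<Rightarrow> 'a list \<Rightarrow>
    ('a::real_normed_vector \<Rightarrow> 'b::real_normed_vector) \<Rightarrow> 'a \<Rightarrow> 'b" where
  "dir_derivs S P [] f = f"
| "dir_derivs S P (w # ws) f =
     (\<lambda>x. frechet_derivative (dir_derivs S P ws f) (at x within S) (P x w))"

text \<open>
  \<open>|f|\<^bsub>W(m,\<infinity>)(S)\<^esub> \<le> B\<close>. The derivatives in question are continuous on the closed set \<open>S\<close>,
  so that the essential supremum is a supremum.
\<close>

definition sobolev_inf_seminorm_le :: "'a set \<Rightarrow> ('a \<Rightarrow> 'a \<Rightarrow> 'a) \<Rightarrow> nat \<Rightarrow>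
    ('a::euclidean_space \<Rightarrow> 'b::real_normed_vector) \<Rightarrow> real \<Rightarrow> bool" where
  "sobolev_inf_seminorm_le S P m f B \<longleftrightarrow>
     (\<forall>ws. length ws = m \<and> set ws \<subseteq> Basis \<longrightarrow> (\<forall>x\<in>S. norm (dir_derivs S P ws f x) \<le> B))"

section \<open>The exact surface\<close>

definition smooth_surface :: "(real^3) set \<Rightarrow> bool" where
  "smooth_surface \<gamma> \<longleftrightarrow>
     (\<forall>x\<in>\<gamma>. \<exists>U (\<phi> :: real^3 \<Rightarrow> real). open U \<and> x \<in> U \<and> smooth_on U \<phi> \<and> (\<forall>y\<in>U. grad \<phi> y \<noteq> 0) \<and>
        \<gamma> \<inter> U = {y\<in>U. \<phi> y = 0})"

definition signed_dist :: "(real^3) set \<Rightarrow> real^3 \<Rightarrow> real" where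
  "signed_dist \<Omega> x = (if x \<in> \<Omega> then - infdist x (frontier \<Omega>) else infdist x (frontier \<Omega>))"

definition tube :: "(real^3) set \<Rightarrow> real \<Rightarrow> (real^3) set" where
  "tube \<gamma> \<delta> = {x. infdist x \<gamma> < \<delta>}"

definition closest_point_proj :: "(real^3) set \<Rightarrow> real^3 \<Rightarrow> real^3" where
  "closest_point_proj \<Omega> x = x - signed_dist \<Omega> x *\<^sub>R grad (signed_dist \<Omega>) x"

text \<open>
  \<open>\<Omega>\<close> is the bounded region enclosed by the closed surface \<open>\<gamma>\<close>; it fixes the outward direction.
  Smoothness of the signed distance across \<open>\<gamma>\<close> provides the smooth unit normal field
  \<open>\<nu> = \<nabla>d\<close> that orients \<open>\<gamma>\<close>.
\<close>

definition exact_surface :: "(real^3) set \<Rightarrow> (real^3) set \<Rightarrow> real \<Rightarrow> bool" where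
  "exact_surface \<gamma> \<Omega> \<delta> \<longleftrightarrow>
     open \<Omega> \<and> bounded \<Omega> \<and> frontier \<Omega> = \<gamma> \<and> \<gamma> \<noteq> {} \<and> smooth_surface \<gamma> \<and>
     \<delta> > 0 \<and> smooth_on (tube \<gamma> \<delta>) (signed_dist \<Omega>) \<and>
     (\<forall>x\<in>tube \<gamma> \<delta>. \<exists>!y. y \<in> \<gamma> \<and> dist x y = infdist x \<gamma>)"

section \<open>Affine meshes\<close>

definition verts :: "(real^3) set \<Rightarrow> (real^3) set" where
  "verts T = {x. x extreme_point_of T}"

text \<open>
  A conforming set of flat triangles without boundary: every edge lies in exactly two triangles, and
  the triangles around a vertex form one cycle.
\<close>

definition closed_polyhedral_surface :: "(real^3) set set \<Rightarrow> bool" where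
  "closed_polyhedral_surface \<T> \<longleftrightarrow>
     \<T> \<noteq> {} \<and> triangulation \<T> \<and> (\<forall>T\<in>\<T>. 2 simplex T) \<and>
     (\<forall>T\<in>\<T>. \<forall>e. e edge_of T \<longrightarrow> card {T'\<in>\<T>. e edge_of T'} = 2) \<and>
     (\<forall>T\<in>\<T>. \<forall>T'\<in>\<T>. \<forall>a\<in>verts T \<inter> verts T'.
        (T, T') \<in> {(S, S'). S \<in> \<T> \<and> S' \<in> \<T> \<and> (\<exists>e. a \<in> e \<and> e edge_of S \<and> e edge_of S')}\<^sup>*)"

definition mesh_size :: "(real^3) set set \<Rightarrow> real" where
  "mesh_size \<T> = Max (diameter ` \<T>)"

definition shape_regular :: "real \<Rightarrow> (real^3) set set \<Rightarrow> bool" where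
  "shape_regular C \<T> \<longleftrightarrow>
     (\<forall>T\<in>\<T>. \<exists>x\<in>T. cball x (diameter T / C) \<inter> affine hull T \<subseteq> T)"

definition affine_mesh :: "real \<Rightarrow> (real^3) set \<Rightarrow> (real^3) set \<Rightarrow> real \<Rightarrow> (real^3) set set \<Rightarrow> bool" where
  "affine_mesh C \<gamma> \<Omega> \<delta> \<T> \<longleftrightarrow>
     closed_polyhedral_surface \<T> \<and> shape_regular C \<T> \<and> \<Union>\<T> \<subseteq> tube \<gamma> \<delta> \<and>
     (\<forall>x\<in>\<Union>\<T>. \<bar>signed_dist \<Omega> x\<bar> \<le> C * mesh_size \<T> ^ 2)"

definition barycenter :: "(real^3) set \<Rightarrow> real^3" where
  "barycenter T = (1/3) *\<^sub>R (\<Sum>x\<in>verts T. x)"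

definition clough_tocher :: "(real^3) set set \<Rightarrow> (real^3) set set" where
  "clough_tocher \<T> =
     (\<Union>T\<in>\<T>. (\<lambda>x. convex hull (insert (barycenter T) (verts T - {x}))) ` verts T)"

definition ref_triangle :: "(real^2) set" where
  "ref_triangle = convex hull {vector [1, 0], vector [0, 1], 0}"

abbreviation D_ref :: "(real^2 \<Rightarrow> real^3) \<Rightarrow> real^2 \<Rightarrow> real^2 \<Rightarrow> real^3" where
  "D_ref G x \<equiv> frechet_derivative G (at x within ref_triangle)"

definition gram_det :: "(real^2 \<Rightarrow> real^3) \<Rightarrow> real^2 \<Rightarrow> real" where
  "gram_det G x = det (transpose (matrix (D_ref G x)) ** matrix (D_ref G x))"

definition affine_param :: "real \<Rightarrow> (real^3) set \<Rightarrow> (real^2 \<Rightarrow> real^3) \<Rightarrow> bool" where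
  "affine_param C Kb F \<longleftrightarrow>
     linear (\<lambda>x. F x - F 0) \<and> bij_betw F ref_triangle Kb \<and>
     (\<forall>x\<in>ref_triangle.
        onorm (D_ref F x) \<le> C * diameter Kb \<and>
        diameter Kb ^ 4 / C \<le> gram_det F x \<and> gram_det F x \<le> C * diameter Kb ^ 4)"

section \<open>The high-order surface\<close>

text \<open>The last clause compares the surface gradients: \<open>y - z\<close> ranges over tangent vectors of \<open>Kb\<close>.\<close>

definition high_order_map ::
    "real \<Rightarrow> nat \<Rightarrow> (real^3) set \<Rightarrow> (real^3) set set \<Rightarrow> (real^3 \<Rightarrow> real^3) \<Rightarrow> bool" where
  "high_order_map C k \<Omega> \<T> \<Psi> \<longleftrightarrow>
     continuous_on (\<Union>\<T>) \<Psi> \<and> inj_on \<Psi> (\<Union>\<T>) \<and>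
     (\<forall>Kb\<in>clough_tocher \<T>. \<forall>i. \<exists>p\<in>poly_le k. \<forall>x\<in>Kb. \<Psi> x $ i = p x) \<and>
     (\<forall>x\<in>\<Union>\<T>. norm (closest_point_proj \<Omega> x - \<Psi> x) \<le> C * mesh_size \<T> ^ (k + 1)) \<and>
     (\<forall>Kb\<in>clough_tocher \<T>. \<forall>x\<in>Kb. \<forall>y\<in>Kb. \<forall>z\<in>Kb.
        norm (frechet_derivative (closest_point_proj \<Omega>) (at x) (y - z)
              - frechet_derivative \<Psi> (at x within Kb) (y - z))
          \<le> C * mesh_size \<T> ^ k * norm (y - z))"

definition tangent_proj :: "(real^3 \<Rightarrow> real^3) \<Rightarrow> real^3 \<Rightarrow> real^3 \<Rightarrow> real^3" where
  "tangent_proj \<nu> x w = w - (w \<bullet> \<nu> x) *\<^sub>R \<nu> x"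

text \<open>
  \<open>G = \<Psi> \<circ> F\<^bsub>Kb\<^esub>\<close> parametrizes the curved element, \<open>\<nu>\<close> is its unit normal and \<open>hK\<close> its
  size. \<open>G\<close> is a bijective polynomial map onto its image, and the lower bound on the Gram
  determinant makes it an immersion up to the boundary: it is a diffeomorphism.
\<close>

definition curved_param ::
    "real \<Rightarrow> nat \<Rightarrow> real \<Rightarrow> (real^3 \<Rightarrow> real^3) \<Rightarrow> (real^2 \<Rightarrow> real^3) \<Rightarrow> bool" where
  "curved_param C k hK \<nu> G \<longleftrightarrow>
     inj_on G ref_triangle \<and>
     (\<forall>i. \<exists>p\<in>poly_le k. \<forall>x\<in>ref_triangle. G x $ i = p x) \<and>
     (\<forall>m\<in>{1..k+1}.
        sobolev_inf_seminorm_le ref_triangle (\<lambda>_ w. w) m G (C * hK ^ m) \<and>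
        sobolev_inf_seminorm_le (G ` ref_triangle) (tangent_proj \<nu>) m
          (the_inv_into ref_triangle G) (C / hK)) \<and>
     (\<forall>x\<in>ref_triangle. hK ^ 4 / C \<le> gram_det G x \<and> gram_det G x \<le> C * hK ^ 4)"

text \<open>
  Outward unit normal of the closed, piecewise smooth surface \<open>\<Gamma>\<^sub>h = frontier \<Omega>\<^sub>h\<close>, given
  elementwise. \<open>coherent_normal\<close> is the usual orientation condition for piecewise smooth
  surfaces: two elements with a common edge induce opposite orientations on it. Here \<open>t\<close> is tangent
  to the edge, so the cross product of \<open>t\<close> and \<open>\<nu>\<close> is, up to scaling, co-normal, and \<open>a\<close>, \<open>a'\<close> point from the edge
  into the respective element.
\<close>

definition coherent_normal ::
    "(real^3) set set \<Rightarrow> (real^3 \<Rightarrow> real^3) \<Rightarrow> ((real^3) set \<Rightarrow> real^3 \<Rightarrow> real^3) \<Rightarrow> bool" where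
  "coherent_normal \<K> \<Psi> \<nu> \<longleftrightarrow>
     (\<forall>Kb\<in>\<K>. \<forall>Kb'\<in>\<K>. \<forall>A B P P'.
        Kb \<noteq> Kb' \<and> A \<noteq> B \<and> verts Kb = {A, B, P} \<and> verts Kb' = {A, B, P'} \<longrightarrow>
        (\<forall>x\<in>open_segment A B.
           let t = frechet_derivative \<Psi> (at x within Kb) (B - A);
               a = frechet_derivative \<Psi> (at x within Kb) (P - x);
               a' = frechet_derivative \<Psi> (at x within Kb') (P' - x)
           in (cross3 t (\<nu> Kb (\<Psi> x)) \<bullet> a) * (cross3 t (\<nu> Kb' (\<Psi> x)) \<bullet> a') < 0))"

definition outward_unit_normal ::
    "(real^3) set \<Rightarrow> (real^3) set set \<Rightarrow> ((real^3) set \<Rightarrow> real^2 \<Rightarrow> real^3) \<Rightarrow>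
     (real^3 \<Rightarrow> real^3) \<Rightarrow> ((real^3) set \<Rightarrow> real^3 \<Rightarrow> real^3) \<Rightarrow> bool" where
  "outward_unit_normal \<Omega>\<^sub>h \<K> F \<Psi> \<nu> \<longleftrightarrow>
     open \<Omega>\<^sub>h \<and> bounded \<Omega>\<^sub>h \<and> frontier \<Omega>\<^sub>h = \<Psi> ` \<Union>\<K> \<and>
     (\<forall>Kb\<in>\<K>.
        continuous_on (\<Psi> ` Kb) (\<nu> Kb) \<and>
        (\<forall>x\<in>ref_triangle. norm (\<nu> Kb (\<Psi> (F Kb x))) = 1 \<and>
           (\<forall>w. \<nu> Kb (\<Psi> (F Kb x)) \<bullet> D_ref (\<Psi> \<circ> F Kb) x w = 0)) \<and>
        (\<forall>x\<in>interior ref_triangle. let y = \<Psi> (F Kb x) in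
           \<exists>\<epsilon>>0. \<forall>s. 0 < s \<and> s < \<epsilon> \<longrightarrow>
             y + s *\<^sub>R \<nu> Kb y \<notin> closure \<Omega>\<^sub>h \<and> y - s *\<^sub>R \<nu> Kb y \<in> \<Omega>\<^sub>h)) \<and>
     coherent_normal \<K> \<Psi> \<nu>"

text \<open>
  \<open>\<K>\<close> is the affine Clough--Tocher mesh, \<open>F Kb\<close> the affine parametrization of \<open>Kb \<in> \<K>\<close>.
\<close>

definition high_order_surface ::
    "real \<Rightarrow> nat \<Rightarrow> (real^3) set \<Rightarrow> (real^3) set set \<Rightarrow> ((real^3) set \<Rightarrow> real^2 \<Rightarrow> real^3) \<Rightarrow>
     (real^3 \<Rightarrow> real^3) \<Rightarrow> (real^3) set \<Rightarrow> ((real^3) set \<Rightarrow> real^3 \<Rightarrow> real^3) \<Rightarrow> bool" where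
  "high_order_surface C k \<Omega> \<T> F \<Psi> \<Omega>\<^sub>h \<nu> \<longleftrightarrow>
     (let \<K> = clough_tocher \<T> in
       (\<forall>Kb\<in>\<K>. affine_param C Kb (F Kb)) \<and>
       high_order_map C k \<Omega> \<T> \<Psi> \<and>
       outward_unit_normal \<Omega>\<^sub>h \<K> F \<Psi> \<nu> \<and>
       (\<forall>Kb\<in>\<K>. curved_param C k (diameter Kb) (\<nu> Kb) (\<Psi> \<circ> F Kb)))"

section \<open>Surface calculus on a curved element\<close>

definition surf_div :: "(real^3) set \<Rightarrow> (real^3 \<Rightarrow> real^3) \<Rightarrow> (real^3 \<Rightarrow> real^3) \<Rightarrow> real^3 \<Rightarrow> real" where
  "surf_div K \<nu> v x =
     (\<Sum>b\<in>Basis. frechet_derivative v (at x within K) (tangent_proj \<nu> x b) \<bullet> b)"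

definition J :: "(real^2 \<Rightarrow> real^3) \<Rightarrow> real^2 \<Rightarrow> real" where
  "J G x = sqrt (gram_det G x)"

text \<open>Surface integral and square-integrability over the element \<open>G ` ref_triangle\<close>.\<close>

definition surf_integral :: "(real^2 \<Rightarrow> real^3) \<Rightarrow> (real^3 \<Rightarrow> real) \<Rightarrow> real" where
  "surf_integral G f = (LINT x:ref_triangle|lborel. f (G x) * J G x)"

definition surf_L2 :: "(real^2 \<Rightarrow> real^3) \<Rightarrow> (real^3 \<Rightarrow> 'b::euclidean_space) \<Rightarrow> bool" where
  "surf_L2 G f \<longleftrightarrow>
     set_borel_measurable lborel ref_triangle (\<lambda>x. f (G x)) \<and>
     set_integrable lborel ref_triangle (\<lambda>x. (norm (f (G x)))\<^sup>2 * J G x)"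

definition piola :: "(real^2 \<Rightarrow> real^3) \<Rightarrow> (real^2 \<Rightarrow> real^2) \<Rightarrow> real^3 \<Rightarrow> real^3" where
  "piola G vh x =
     (let y = the_inv_into ref_triangle G x in inverse (J G y) *\<^sub>R D_ref G y (vh y))"

section \<open>Nodes\<close>

text \<open>
  The \<open>(r+1)\<close>-point Gauss--Lobatto nodes on \<open>[-1,1]\<close>: the end points and the zeros of the derivative
  of the Legendre polynomial of degree \<open>r\<close>, which by Rodrigues' formula is a multiple of the
  \<open>r\<close>-th derivative of \<open>(x\<^sup>2 - 1)^r\<close>.
\<close>

definition gauss_lobatto :: "nat \<Rightarrow> real set" where
  "gauss_lobatto r = {-1, 1} \<union> {s. poly (pderiv ((pderiv ^^ r) ([:-1, 0, 1:] ^ r))) s = 0}"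

definition edge_nodes :: "nat \<Rightarrow> real^3 \<Rightarrow> real^3 \<Rightarrow> (real^3) set" where
  "edge_nodes r A B = (\<lambda>s. ((1 - s) / 2) *\<^sub>R A + ((1 + s) / 2) *\<^sub>R B) ` gauss_lobatto r"

text \<open>
  Degree-\<open>r\<close> Lagrange nodes: on each triangle a unisolvent set with as many points as the dimension
  of the polynomial space. The position of the nodes is prescribed on the edges only.
\<close>

definition lagrange_nodes :: "nat \<Rightarrow> (real^3) set set \<Rightarrow> (real^3) set \<Rightarrow> bool" where
  "lagrange_nodes r \<K> N \<longleftrightarrow>
     N \<subseteq> \<Union>\<K> \<and>
     (\<forall>Kb\<in>\<K>.
        card (N \<inter> Kb) = (r + 1) * (r + 2) div 2 \<and>
        (\<forall>p\<in>poly_le r. (\<forall>a\<in>N \<inter> Kb. p a = 0) \<longrightarrow> (\<forall>x\<in>Kb. p x = 0)) \<and>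
        (\<forall>A\<in>verts Kb. \<forall>B\<in>verts Kb. A \<noteq> B \<longrightarrow> N \<inter> closed_segment A B = edge_nodes r A B))"

text \<open>Elements abutting the node \<open>a\<close> of the curved mesh.\<close>

definition elements_at :: "(real^3) set set \<Rightarrow> (real^3 \<Rightarrow> real^3) \<Rightarrow> real^3 \<Rightarrow> (real^3) set set" where
  "elements_at \<K> \<Psi> a = {Kb\<in>\<K>. a \<in> \<Psi> ` Kb}"

text \<open>\<open>n0\<close> and \<open>n\<close> are the normals of the elements \<open>K\<^sub>a\<close> and \<open>K\<close> at \<open>a\<close>.\<close>

definition node_transfer :: "real^3 \<Rightarrow> real^3 \<Rightarrow> real^3 \<Rightarrow> real^3" where
  "node_transfer n0 n x = (n0 \<bullet> n) *\<^sub>R x - (n \<bullet> x) *\<^sub>R n0"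

section \<open>The Scott--Vogelius pair\<close>

definition local_V :: "nat \<Rightarrow> (real^2 \<Rightarrow> real^3) \<Rightarrow> (real^3 \<Rightarrow> real^3) set" where
  "local_V r G =
     {v. \<exists>vh. (\<forall>i. (\<lambda>x. vh x $ i) \<in> poly_le r) \<and> (\<forall>x\<in>G ` ref_triangle. v x = piola G vh x)}"

definition local_Q :: "nat \<Rightarrow> (real^2 \<Rightarrow> real^3) \<Rightarrow> (real^3 \<Rightarrow> real) set" where
  "local_Q r G =
     {q. \<exists>qh\<in>poly_le (r - 1). \<forall>x\<in>G ` ref_triangle. q x = qh (the_inv_into ref_triangle G x)}"

text \<open>\<open>N\<close> is the set of affine nodes, and \<open>Ka a\<close> is the element selected at the curved node \<open>a\<close>.\<close>

definition V_h ::
    "nat \<Rightarrow> (real^3) set set \<Rightarrow> ((real^3) set \<Rightarrow> real^2 \<Rightarrow> real^3) \<Rightarrow> (real^3 \<Rightarrow> real^3) \<Rightarrow>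
     ((real^3) set \<Rightarrow> real^3 \<Rightarrow> real^3) \<Rightarrow> (real^3) set \<Rightarrow> (real^3 \<Rightarrow> (real^3) set) \<Rightarrow>
     ((real^3) set \<Rightarrow> real^3 \<Rightarrow> real^3) set" where
  "V_h r \<K> F \<Psi> \<nu> N Ka =
     {v. (\<forall>Kb\<in>\<K>. surf_L2 (\<Psi> \<circ> F Kb) (v Kb) \<and> v Kb \<in> local_V r (\<Psi> \<circ> F Kb)) \<and>
         (\<forall>a\<in>\<Psi> ` N. \<forall>Kb\<in>elements_at \<K> \<Psi> a.
            v Kb a = node_transfer (\<nu> (Ka a) a) (\<nu> Kb a) (v (Ka a) a))}"

definition Q_h ::
    "nat \<Rightarrow> (real^3) set set \<Rightarrow> ((real^3) set \<Rightarrow> real^2 \<Rightarrow> real^3) \<Rightarrow> (real^3 \<Rightarrow> real^3) \<Rightarrow>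
     ((real^3) set \<Rightarrow> real^3 \<Rightarrow> real) set" where
  "Q_h r \<K> F \<Psi> =
     {q. (\<forall>Kb\<in>\<K>. surf_L2 (\<Psi> \<circ> F Kb) (q Kb) \<and> q Kb \<in> local_Q r (\<Psi> \<circ> F Kb)) \<and>
         (\<Sum>Kb\<in>\<K>. surf_integral (\<Psi> \<circ> F Kb) (q Kb)) = 0}"

end

theory Submission
  imports Defs
begin

text \<open>
  Why the theorem holds. On an element \<open>K\<close> parametrized by \<open>G = \<Psi> \<circ> F K\<close> the velocity is the Piola
  transform of a polynomial field \<open>w\<close> on the reference triangle, and the Piola transform is made so
  that \<open>J G * (surf_div v \<circ> G) = div w\<close>, also on the curved element (\<open>surf_div_piola\<close>). The right-hand
  side \<open>d\<close> is a polynomial of degree at most \<open>r - 1\<close>. Hence the pairing of the surface divergence with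
  a pressure \<open>q\<close> is the sum of the integrals of \<open>d * (q \<circ> G)\<close> over the reference triangle, with no
  Jacobian left. The obvious test function is \<open>q \<circ> G = d\<close>; it lies in the local pressure spaces but
  need not have mean zero on the surface, so a constant \<open>c\<close> is subtracted. Testing with \<open>d - c\<close> gives
  \<open>\<Sum> \<integral> d\<^sup>2 = c * \<Sum> \<integral> d\<close>, and everything rests on the compatibility condition \<open>\<Sum> \<integral> d = 0\<close>, that is,
  on the vanishing of the total flux of \<open>v\<close> out of all elements (\<open>divergence\<close>). Then \<open>d = 0\<close> on every
  element, hence so is the surface divergence.

  By the divergence theorem on the reference triangle (\<open>divergence_ref_triangle\<close>) the integral of \<open>d\<close>
  is a sum of fluxes through the three edges. An edge of the Clough--Tocher mesh lies in exactly two
  elements (\<open>clough_tocher_edge\<close>), so it suffices that the two fluxes through a common edge cancel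
  (\<open>edge_fluxes_cancel\<close>). Let \<open>t\<close> be tangent to the edge and \<open>n\<close> the normal of the element. Up to an
  orientation sign, the flux density is the co-normal component \<open>v \<bullet> (t \<times> n)\<close>
  (\<open>conormal_piola\<close>). The nodal coupling can be written as the double cross product
  \<open>v = n \<times> (v\<^sub>0 \<times> n\<^sub>0)\<close>, where \<open>v\<^sub>0\<close> and \<open>n\<^sub>0\<close> belong to the element selected at the node; since \<open>n\<close> is a unit
  vector orthogonal to \<open>t\<close>, the co-normal component equals \<open>- (v\<^sub>0 \<times> n\<^sub>0) \<bullet> t\<close>, in which the element no
  longer occurs (\<open>node_transfer_conormal\<close>). So the flux densities of two neighbours agree up to sign at
  the Gauss--Lobatto nodes of the edge. There are \<open>r + 1\<close> of these (\<open>gauss_lobatto_points\<close>) and the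
  densities are polynomials of degree at most \<open>r\<close> along the edge, so they agree everywhere
  (\<open>signed_flux_agrees\<close>). The signs are opposite because the normals are coherently oriented
  (\<open>opposite_orientation\<close>).
\<close>

section \<open>Polynomials of bounded degree\<close>

lemma poly_le_monomial:
  fixes e :: "'n::finite \<Rightarrow> nat"
  assumes "(\<Sum>i\<in>UNIV. e i) \<le> m"
  shows "(\<lambda>x::real^'n. c * (\<Prod>i\<in>UNIV. (x $ i) ^ e i)) \<in> poly_le m"
  unfolding poly_le_def
proof (intro CollectI exI[of _ "\<lambda>e'. if e' = e then c else 0"] ext)
  fix x :: "real^'n"
  show "c * (\<Prod>i\<in>UNIV. x $ i ^ e i) = (\<Sum>e' | sum e' UNIV \<le> m.
      (if e' = e then c else 0) * (\<Prod>i\<in>UNIV. x $ i ^ e' i))"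
    using assms finite_multi_indices[of m]
    by (subst sum.mono_neutral_right[of _ "{e}"]) auto
qed

lemma poly_le_const: "(\<lambda>x::real^'n. c) \<in> poly_le m"
  using poly_le_monomial[of "\<lambda>_. 0" m c] by simp

lemma poly_le_add:
  assumes "p \<in> poly_le m" "q \<in> poly_le m"
  shows "(\<lambda>x. p x + q x) \<in> poly_le m"
proof -
  obtain c d where
    "p = (\<lambda>x. \<Sum>e | (\<Sum>i\<in>UNIV. e i) \<le> m. c e * (\<Prod>i\<in>UNIV. (x $ i) ^ e i))"
    "q = (\<lambda>x. \<Sum>e | (\<Sum>i\<in>UNIV. e i) \<le> m. d e * (\<Prod>i\<in>UNIV. (x $ i) ^ e i))"
    using assms by (auto simp: poly_le_def)
  then have "(\<lambda>x. p x + q x) =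
      (\<lambda>x. \<Sum>e | (\<Sum>i\<in>UNIV. e i) \<le> m. (c e + d e) * (\<Prod>i\<in>UNIV. (x $ i) ^ e i))"
    by (simp add: sum.distrib distrib_right)
  then show ?thesis by (auto simp: poly_le_def)
qed

lemma poly_le_induct [consumes 1, case_names add monomial]:
  fixes p :: "real^'n \<Rightarrow> real"
  assumes p: "p \<in> poly_le m"
    and add: "\<And>p q. P p \<Longrightarrow> P q \<Longrightarrow> P (\<lambda>x. p x + q x)"
    and monomial: "\<And>c e. (\<Sum>i\<in>UNIV. e i) \<le> m \<Longrightarrow> P (\<lambda>x. c * (\<Prod>i\<in>UNIV. (x $ i) ^ e i))"
  shows "P p"
proof -
  obtain c where c: "p = (\<lambda>x. \<Sum>e | (\<Sum>i\<in>UNIV. e i) \<le> m. c e * (\<Prod>i\<in>UNIV. (x $ i) ^ e i))"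
    using p by (auto simp: poly_le_def)
  have "P (\<lambda>x. \<Sum>e\<in>A. c e * (\<Prod>i\<in>UNIV. (x $ i) ^ e i))"
    if "finite A" "A \<subseteq> {e. (\<Sum>i\<in>UNIV. e i) \<le> m}" for A
    using that
  proof (induction A)
    case empty
    show ?case using monomial[of "\<lambda>_. 0" 0] by simp
  next
    case (insert e A)
    then show ?case using add[OF monomial[of e "c e"] insert.IH] by simp
  qed
  from this[OF finite_multi_indices order_refl] show ?thesis by (simp add: c)
qed

lemma poly_le_differentiable:
  assumes "p \<in> poly_le m"
  shows "p differentiable (at x within S)"
  using assms
proof (induction rule: poly_le_induct)
  case (add p q)
  then show ?case by (rule differentiable_add)
next
  case (monomial c e)
  have "(\<lambda>x::real^'a. x $ i) differentiable (at x within S)" for i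
    by (rule bounded_linear_imp_differentiable[OF bounded_linear_vec_nth])
  then have "(\<lambda>x::real^'a. \<Prod>i\<in>I. x $ i ^ e i) differentiable (at x within S)" for I
    by (induction I rule: infinite_finite_induct) (auto intro!: differentiable_mult differentiable_power)
  then show ?case by (intro differentiable_mult) auto
qed

lemma poly_le_continuous: "p \<in> poly_le m \<Longrightarrow> continuous_on S p"
  by (auto intro!: differentiable_imp_continuous_on poly_le_differentiable simp: differentiable_on_def)

text \<open>
  The alternative \<open>c = 0\<close> covers derivatives of monomials: when the differentiated variable is absent,
  the truncated exponent would give a wrong degree bound, but the coefficient vanishes.
\<close>

lemma poly_le_2_monomial:
  fixes a b :: nat
  assumes "c = 0 \<or> a + b \<le> m"
  shows "(\<lambda>x::real^2. c * ((x $ 1) ^ a * (x $ 2) ^ b)) \<in> poly_le m"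
proof (cases "c = 0")
  case True
  then show ?thesis using poly_le_const[of 0] by simp
next
  case False
  then have "(\<Sum>i\<in>UNIV. (\<lambda>i::2. if i = 1 then a else b) i) \<le> m"
    using assms by (simp add: UNIV_2)
  from poly_le_monomial[OF this, of c] show ?thesis
    by (simp add: UNIV_2)
qed

definition has_partials :: "(real^2 \<Rightarrow> real) \<Rightarrow> (real^2 \<Rightarrow> real) \<Rightarrow> (real^2 \<Rightarrow> real) \<Rightarrow> bool" where
  "has_partials p d1 d2 \<longleftrightarrow>
    (\<forall>x. (p has_derivative (\<lambda>h. h $ 1 * d1 x + h $ 2 * d2 x)) (at x))"

lemma has_partials_add:
  assumes "has_partials p d1 d2" "has_partials q e1 e2"
  shows "has_partials (\<lambda>x. p x + q x) (\<lambda>x. d1 x + e1 x) (\<lambda>x. d2 x + e2 x)"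
  unfolding has_partials_def
proof
  fix x
  have "((\<lambda>x. p x + q x) has_derivative
      (\<lambda>h. (h $ 1 * d1 x + h $ 2 * d2 x) + (h $ 1 * e1 x + h $ 2 * e2 x))) (at x)"
    using assms by (intro has_derivative_add) (auto simp: has_partials_def)
  then show "((\<lambda>x. p x + q x) has_derivative
      (\<lambda>h. h $ 1 * (d1 x + e1 x) + h $ 2 * (d2 x + e2 x))) (at x)"
    by (simp add: algebra_simps)
qed

lemma has_partials_monomial:
  "has_partials (\<lambda>x. c * ((x $ 1) ^ a * (x $ 2) ^ b))
     (\<lambda>x. (c * real a) * ((x $ 1) ^ (a - 1) * (x $ 2) ^ b))
     (\<lambda>x. (c * real b) * ((x $ 1) ^ a * (x $ 2) ^ (b - 1)))"
proof -
  have nth: "((\<lambda>x::real^2. x $ i) has_derivative (\<lambda>h. h $ i)) (at x)" for x i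
    by (rule bounded_linear_imp_has_derivative) (rule bounded_linear_vec_nth)
  have "((\<lambda>x::real^2. c * ((x $ 1) ^ a * (x $ 2) ^ b)) has_derivative
      (\<lambda>h. c * ((x $ 1) ^ a * (real b * h $ 2 * (x $ 2) ^ (b - 1))
          + (real a * h $ 1 * (x $ 1) ^ (a - 1)) * (x $ 2) ^ b))) (at x)" for x
    by (intro has_derivative_mult_right has_derivative_mult has_derivative_power nth)
  then show ?thesis
    unfolding has_partials_def by (simp add: algebra_simps)
qed

text \<open>
  The same function \<open>d12\<close> serves as both mixed second derivatives. This symmetry is what makes the
  curvature terms cancel in the divergence of a Piola transform.
\<close>

lemma poly_le_partials:
  fixes p :: "real^2 \<Rightarrow> real"
  assumes "p \<in> poly_le m"
  obtains d1 d2 d11 d12 d22 where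
    "d1 \<in> poly_le (m - 1)" "d2 \<in> poly_le (m - 1)" "has_partials p d1 d2"
    "has_partials d1 d11 d12" "has_partials d2 d12 d22"
proof -
  have "\<exists>d1\<in>poly_le (m - 1). \<exists>d2\<in>poly_le (m - 1). \<exists>d11 d12 d22.
      has_partials p d1 d2 \<and> has_partials d1 d11 d12 \<and> has_partials d2 d12 d22"
    using assms
  proof (induction rule: poly_le_induct)
    case (add p q)
    from add.IH show ?case
      by (elim bexE exE conjE, intro bexI exI conjI)
         (rule has_partials_add poly_le_add; assumption)+
  next
    case (monomial c e)
    define a b where "a = e 1" and "b = e 2"
    have ab: "a + b \<le> m" using monomial by (simp add: a_def b_def UNIV_2)
    let ?d1 = "\<lambda>x::real^2. (c * real a) * ((x $ 1) ^ (a - 1) * (x $ 2) ^ b)"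
    let ?d2 = "\<lambda>x::real^2. (c * real b) * ((x $ 1) ^ a * (x $ 2) ^ (b - 1))"
    let ?d12 = "\<lambda>x::real^2. (c * real a * real b) * ((x $ 1) ^ (a - 1) * (x $ 2) ^ (b - 1))"
    have "?d1 \<in> poly_le (m - 1)" "?d2 \<in> poly_le (m - 1)"
      by (rule poly_le_2_monomial, use ab in \<open>cases a; cases b; simp; linarith\<close>)+
    moreover have "has_partials (\<lambda>x::real^2. c * (\<Prod>i\<in>UNIV. (x $ i) ^ e i)) ?d1 ?d2"
      using has_partials_monomial[of c a b] by (simp add: a_def b_def UNIV_2)
    moreover have "has_partials ?d1 (\<lambda>x. (c * real a * real (a - 1)) * ((x $ 1) ^ (a - 1 - 1) * (x $ 2) ^ b)) ?d12"
      by (rule has_partials_monomial)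
    moreover have "has_partials ?d2 ?d12 (\<lambda>x. (c * real b * real (b - 1)) * ((x $ 1) ^ a * (x $ 2) ^ (b - 1 - 1)))"
      using has_partials_monomial[of "c * real b" a "b - 1"] by (simp add: mult_ac)
    ultimately show ?case by blast
  qed
  then show ?thesis using that by blast
qed

lemma poly_le_on_line:
  fixes p :: "real^'n \<Rightarrow> real"
  assumes "p \<in> poly_le m"
  obtains u where "degree u \<le> m" "\<And>s. p (A + s *\<^sub>R t) = poly u s"
proof -
  have "\<exists>u. degree u \<le> m \<and> (\<forall>s. p (A + s *\<^sub>R t) = poly u s)"
    using assms
  proof (induction rule: poly_le_induct)
    case (add p q)
    then obtain u w where "degree u \<le> m" "\<forall>s. p (A + s *\<^sub>R t) = poly u s"
      "degree w \<le> m" "\<forall>s. q (A + s *\<^sub>R t) = poly w s" by blast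
    then show ?case by (intro exI[of _ "u + w"]) (auto intro: degree_add_le)
  next
    case (monomial c e)
    let ?u = "smult c (\<Prod>i\<in>UNIV. [:A $ i, t $ i:] ^ e i)"
    have "degree ?u \<le> (\<Sum>i\<in>UNIV. degree ([:A $ i, t $ i:] ^ e i))"
      by (rule order_trans[OF degree_smult_le]) (use degree_prod_sum_le[of UNIV "\<lambda>i. [:A $ i, t $ i:] ^ e i"] in \<open>simp add: o_def\<close>)
    also have "\<dots> \<le> (\<Sum>i\<in>UNIV. e i)"
    proof (rule sum_mono)
      fix i
      have "degree ([:A $ i, t $ i:] ^ e i) \<le> degree [:A $ i, t $ i:] * e i"
        by (rule degree_power_le)
      also have "\<dots> \<le> e i" by simp
      finally show "degree ([:A $ i, t $ i:] ^ e i) \<le> e i" .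
    qed
    finally have "degree ?u \<le> m" using monomial by simp
    moreover have "c * (\<Prod>i\<in>UNIV. (A + s *\<^sub>R t) $ i ^ e i) = poly ?u s" for s
      by (simp add: poly_prod mult_ac)
    ultimately show ?case by blast
  qed
  then show ?thesis using that by blast
qed

section \<open>Gauss--Lobatto nodes\<close>

text \<open>
  Rolle's theorem, applied between neighbouring elements of \<open>S\<close>. The roots obtained lie strictly inside
  the range of \<open>S\<close>, so that in an iteration they stay apart from the end points.
\<close>

lemma pderiv_roots:
  fixes p :: "real poly"
  assumes "finite S" "card S = Suc n" "\<And>s. s \<in> S \<Longrightarrow> poly p s = 0"
  shows "\<exists>R. finite R \<and> card R = n \<and> R \<subseteq> {Min S<..<Max S} \<and> (\<forall>s\<in>R. poly (pderiv p) s = 0)"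
  using assms
proof (induction n arbitrary: S)
  case 0
  then show ?case by (intro exI[of _ "{}"]) auto
next
  case (Suc n)
  define b where "b = Max S"
  define S' where "S' = S - {b}"
  have "S \<noteq> {}" using Suc.prems by auto
  then have bS: "b \<in> S" using Suc.prems by (simp add: b_def)
  then have S': "finite S'" "card S' = Suc n" "S' \<subseteq> S"
    using Suc.prems(1,2) by (simp_all add: S'_def)
  then have "S' \<noteq> {}" by auto
  note S' = S' this
  then obtain R where R: "finite R" "card R = n" "R \<subseteq> {Min S'<..<Max S'}"
    "\<forall>s\<in>R. poly (pderiv p) s = 0"
    using Suc.IH[of S'] Suc.prems by blast
  have MS': "Max S' \<in> S'" using S' by simp
  have lt: "Max S' < b"
    using MS' Suc.prems(1) by (auto simp: S'_def b_def intro: le_neq_trans)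
  have min: "Min S \<le> Min S'" using S' Suc.prems(1) by (intro Min_antimono) auto
  have min': "Min S \<le> Max S'" using MS' S'(3) Suc.prems(1) by (intro Min_le) auto
  obtain z where z: "Max S' < z" "z < b" "poly (pderiv p) z = 0"
    using poly_MVT[OF lt, of p] Suc.prems(3) bS MS' S' lt
    by (metis (no_types, lifting) diff_self in_mono mult_eq_0_iff right_minus_eq less_irrefl)
  \<comment> \<open>the roots from the induction lie to the left of \<open>Max S'\<close>, the new one to the right\<close>
  have "z \<notin> R" using R(3) z by auto
  then show ?case
    using R z min min' lt by (intro exI[of _ "insert z R"]) (auto simp flip: b_def)
qed

text \<open>
  The polynomial \<open>(x\<^sup>2 - 1)^r\<close> vanishes to order \<open>r\<close> at \<open>\<plusminus>1\<close>. Hence its \<open>j\<close>-th derivative with \<open>j < r\<close> still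
  vanishes at \<open>\<plusminus>1\<close>, and each differentiation adds one root in the open interval. So the
  \<open>r\<close>-th derivative has at least \<open>r\<close> roots there and the next one at least \<open>r - 1\<close>, to which the two end
  points are added.
\<close>

lemma gauss_lobatto_points:
  assumes "r \<ge> 1"
  obtains S where "finite S" "card S = Suc r" "S \<subseteq> gauss_lobatto r" "S \<subseteq> {-1..1}"
proof -
  let ?p = "[:-1, 0, 1:] ^ r :: real poly"
  have div: "[:-1, 0, 1:] ^ (r - j) dvd (pderiv ^^ j) ?p" if "j \<le> r" for j
    using that
  proof (induction j)
    case (Suc j)
    then obtain w where w: "(pderiv ^^ j) ?p = [:-1, 0, 1:] ^ Suc (r - Suc j) * w"
      by (metis Suc_diff_Suc Suc_leD Suc_le_lessD dvdE)
    show ?case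
      by (simp only: funpow.simps o_apply w pderiv_mult pderiv_power_Suc)
         (intro dvd_add dvd_mult2 dvd_smult dvd_mult dvd_power_le[OF dvd_refl] dvd_refl, auto)
  qed simp
  have ends: "poly ((pderiv ^^ j) ?p) s = 0" if "j < r" "s = -1 \<or> s = 1" for j s
  proof -
    have "[:-1, 0, 1:] dvd (pderiv ^^ j) ?p"
      by (rule dvd_trans[OF _ div[of j]]) (use that in \<open>auto intro: dvd_power\<close>)
    then show ?thesis using that by (auto elim!: dvdE)
  qed
  have inner: "\<exists>R. finite R \<and> card R = j \<and> R \<subseteq> {-1<..<1} \<and> (\<forall>s\<in>R. poly ((pderiv ^^ j) ?p) s = 0)"
    if "j \<le> r" for j
    using that
  proof (induction j)
    case 0
    then show ?case by (intro exI[of _ "{}"]) auto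
  next
    case (Suc j)
    then obtain R where R: "finite R" "card R = j" "R \<subseteq> {-1<..<1}"
      "\<forall>s\<in>R. poly ((pderiv ^^ j) ?p) s = 0" by auto
    let ?S = "insert (-1) (insert 1 R)"
    have "-1 \<notin> R" "1 \<notin> R" using R(3) by auto
    then have "card ?S = Suc (Suc j)" using R by (simp add: card_insert_if)
    moreover have "Min ?S = -1"
      by (rule Min_eqI) (use R in auto)
    moreover have "Max ?S = 1"
      by (rule Max_eqI) (use R in auto)
    ultimately show ?case
      using pderiv_roots[of ?S "Suc j" "(pderiv ^^ j) ?p"] R ends[of j] Suc.prems by auto
  qed
  obtain R where R: "finite R" "card R = r" "R \<subseteq> {-1<..<1}" "\<forall>s\<in>R. poly ((pderiv ^^ r) ?p) s = 0"
    using inner by blast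
  have "R \<noteq> {}" using R assms by auto
  obtain R' where R': "finite R'" "card R' = r - 1" "R' \<subseteq> {Min R<..<Max R}"
    "\<forall>s\<in>R'. poly (pderiv ((pderiv ^^ r) ?p)) s = 0"
    using pderiv_roots[of R "r - 1" "(pderiv ^^ r) ?p"] R assms by auto
  have "R' \<subseteq> {-1<..<1}"
    using R'(3) R Min_in[OF R(1) \<open>R \<noteq> {}\<close>] Max_in[OF R(1) \<open>R \<noteq> {}\<close>] by fastforce
  then have "-1 \<notin> R'" "1 \<notin> R'" by auto
  then have "card (insert (-1) (insert 1 R')) = Suc r"
    using R' assms by (simp add: card_insert_if)
  then show thesis
    using R' \<open>R' \<subseteq> {-1<..<1}\<close>
    by (intro that[of "insert (-1) (insert 1 R')"]) (auto simp: gauss_lobatto_def)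
qed

section \<open>Calculus on the reference triangle\<close>

text \<open>
  At a corner of a triangle no coordinate direction need point into the triangle, so uniqueness
  cannot be tested on a basis. Instead, two derivatives agree on all directions \<open>y - x\<close> with \<open>y\<close> in the
  convex set, and these contain a ball if the interior is nonempty.
\<close>

lemma has_derivative_within_convex_unique:
  fixes f :: "'a::real_normed_vector \<Rightarrow> 'b::real_normed_vector"
  assumes S: "convex S" "interior S \<noteq> {}" "x \<in> S"
    and f': "(f has_derivative f') (at x within S)"
    and f'': "(f has_derivative f'') (at x within S)"
  shows "f' = f''"
proof -
  have agree: "f' (y - x) = f'' (y - x)" if "y \<in> S" for y
  proof -
    have seg: "(\<lambda>s::real. x + s *\<^sub>R (y - x)) ` {0..1} \<subseteq> S"
      using S(1,3) that by (force simp: convex_alt algebra_simps)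
    have *: "((\<lambda>s. f (x + s *\<^sub>R (y - x))) has_vector_derivative g (y - x)) (at 0 within {0..1})"
      if "(f has_derivative g) (at x within S)" for g
    proof -
      interpret g: bounded_linear g using that by (rule has_derivative_bounded_linear)
      have "((\<lambda>s::real. x + s *\<^sub>R (y - x)) has_derivative (\<lambda>s. s *\<^sub>R (y - x))) (at 0 within {0..1})"
        by (auto intro!: derivative_eq_intros)
      from diff_chain_within[OF this, of f g] has_derivative_subset[OF that seg]
      show ?thesis
        by (simp add: has_vector_derivative_def o_def g.scaleR)
    qed
    show ?thesis
      by (rule vector_derivative_unique_within_closed_interval[where a=0 and b=1 and x=0])
         (use *[OF f'] *[OF f''] in auto)
  qed
  obtain z e where e: "e > 0" "ball z e \<subseteq> S"
    using S(2) by (auto simp: mem_interior)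
  interpret f': bounded_linear f' using f' by (rule has_derivative_bounded_linear)
  interpret f'': bounded_linear f'' using f'' by (rule has_derivative_bounded_linear)
  show ?thesis
  proof
    fix h :: 'a
    define c where "c = e / (2 * (norm h + 1))"
    have c: "c > 0" using e by (simp add: c_def add_nonneg_pos)
    \<comment> \<open>\<open>c\<close> scales \<open>h\<close> so that \<open>z + c *\<^sub>R h\<close> stays in the ball\<close>
    have "norm (c *\<^sub>R h) < e"
    proof -
      have "norm h < 2 * (norm h + 1)" by (smt (verit) norm_ge_zero)
      then have "e * norm h < e * (2 * (norm h + 1))" using e by simp
      then show ?thesis using e by (simp add: c_def pos_divide_less_eq add_nonneg_pos)
    qed
    then have "z + c *\<^sub>R h \<in> S" "z \<in> S" using e by (auto simp: dist_norm)
    from agree[OF this(1)] agree[OF this(2)]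
    have "f' (c *\<^sub>R h) = f'' (c *\<^sub>R h)"
      by (simp add: f'.add f'.diff f''.add f''.diff) (smt (verit) add.commute add_diff_cancel_left' add_diff_eq)
    then show "f' h = f'' h"
      using c by (simp add: f'.scaleR f''.scaleR)
  qed
qed

lemma ref_triangle_eq: "ref_triangle = {x. 0 \<le> x $ 1 \<and> 0 \<le> x $ 2 \<and> x $ 1 + x $ 2 \<le> 1}"
  unfolding ref_triangle_def convex_hull_3
proof (intro set_eqI iffI)
  fix x :: "real^2"
  assume "x \<in> {x. 0 \<le> x $ 1 \<and> 0 \<le> x $ 2 \<and> x $ 1 + x $ 2 \<le> 1}"
  then show "x \<in> {u *\<^sub>R vector [1, 0] + v *\<^sub>R vector [0, 1] + w *\<^sub>R 0 |u v w.
      0 \<le> u \<and> 0 \<le> v \<and> 0 \<le> w \<and> u + v + w = 1}"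
    by (intro CollectI exI[of _ "x $ 1"] exI[of _ "x $ 2"] exI[of _ "1 - x $ 1 - x $ 2"])
       (auto simp: vec_eq_iff forall_2 vector_2)
qed (auto simp: vector_2)

lemma convex_ref_triangle: "convex ref_triangle"
  by (simp add: ref_triangle_def convex_convex_hull)

lemma compact_ref_triangle: "compact ref_triangle"
  by (simp add: ref_triangle_def compact_convex_hull finite_imp_compact)

lemma interior_ref_triangle: "interior ref_triangle \<noteq> {}"
proof -
  have "open {x::real^2. 0 < x $ 1 \<and> 0 < x $ 2 \<and> x $ 1 + x $ 2 < 1}"
    by (intro open_Collect_conj open_Collect_less continuous_intros)
  then have "{x::real^2. 0 < x $ 1 \<and> 0 < x $ 2 \<and> x $ 1 + x $ 2 < 1} \<subseteq> interior ref_triangle"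
    by (intro interior_maximal) (auto simp: ref_triangle_eq)
  moreover have "vector [1/3, 1/3] \<in> {x::real^2. 0 < x $ 1 \<and> 0 < x $ 2 \<and> x $ 1 + x $ 2 < 1}"
    by (simp add: vector_2)
  ultimately show ?thesis by blast
qed

lemmas ref_triangle_derivative_unique =
  has_derivative_within_convex_unique[OF convex_ref_triangle interior_ref_triangle]

lemma set_integrable_ref_triangle:
  fixes f :: "real^2 \<Rightarrow> real"
  shows "continuous_on ref_triangle f \<Longrightarrow> set_integrable lborel ref_triangle f"
  unfolding set_integrable_def by (rule borel_integrable_compact[OF compact_ref_triangle])

lemma ref_triangle_integral_eq_0:
  fixes f :: "real^2 \<Rightarrow> real"
  assumes f: "continuous_on ref_triangle f" "\<And>x. x \<in> ref_triangle \<Longrightarrow> 0 \<le> f x"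
    and int: "(LINT x:ref_triangle|lborel. f x) = 0" and x: "x \<in> ref_triangle"
  shows "f x = 0"
proof -
  have cl: "closure (interior ref_triangle) = ref_triangle"
    using convex_closure_interior[OF convex_ref_triangle interior_ref_triangle]
      compact_imp_closed[OF compact_ref_triangle] by simp
  have "negligible (ref_triangle - interior ref_triangle)"
    using negligible_convex_frontier[OF convex_ref_triangle]
      compact_imp_closed[OF compact_ref_triangle] by (simp add: frontier_def)
  then have "emeasure lborel (ref_triangle - interior ref_triangle) = 0"
    using compact_imp_closed[OF compact_ref_triangle]
    by (simp add: negligible_iff_emeasure0 emeasure_completion)
  moreover have "emeasure lborel ref_triangle = emeasure lborel (interior ref_triangle)
      + emeasure lborel (ref_triangle - interior ref_triangle)"
    using compact_imp_closed[OF compact_ref_triangle] interior_subset[of ref_triangle]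
    by (subst plus_emeasure) (auto intro!: arg_cong[where f="emeasure lborel"])
  ultimately have em: "emeasure lborel ref_triangle = emeasure lborel (interior ref_triangle)"
    by simp
  have "emeasure lborel (interior ref_triangle) \<noteq> 0"
    using interior_ref_triangle open_not_negligible[OF open_interior, of "ref_triangle"]
    by (simp add: negligible_iff_emeasure0 emeasure_completion)
  moreover have "emeasure lborel (interior ref_triangle) < \<infinity>"
    using em emeasure_bounded_finite[OF compact_imp_bounded[OF compact_ref_triangle]] by simp
  moreover have "(f has_integral 0) ref_triangle"
    using set_borel_integral_eq_integral[OF set_integrable_ref_triangle[OF f(1)]] int
    by (metis integrable_integral)
  ultimately show ?thesis
    using has_integral_0_closure_imp_0[of "interior ref_triangle" f x] f x em cl
      interior_subset[of ref_triangle]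
    by (auto simp: subset_iff zero_less_iff_neq_zero)
qed

lemma vector_2_axis: "vector [a, b] = a *\<^sub>R axis 1 1 + b *\<^sub>R (axis 2 1 :: real^2)"
  by (simp add: vec_eq_iff forall_2 vector_2 axis_def)

text \<open>
  Transfers Lebesgue measure from pairs to \<open>real^2\<close>, so that Fubini's theorem applies. Both orders of
  the coordinates are needed, one for each variable that is integrated first.
\<close>

lemma lborel_vec2:
  fixes \<phi> :: "real \<times> real \<Rightarrow> real^2"
  assumes \<phi>: "\<phi> = (\<lambda>(x, y). vector [x, y]) \<or> \<phi> = (\<lambda>(x, y). vector [y, x])"
  shows "distr (lborel \<Otimes>\<^sub>M lborel) borel \<phi> = lborel" and "\<phi> \<in> borel_measurable borel"
proof -
  have "continuous_on UNIV \<phi>"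
    using \<phi> by (auto simp: case_prod_unfold vector_2_axis intro!: continuous_intros)
  then show m: "\<phi> \<in> borel_measurable borel"
    by (rule borel_measurable_continuous_onI)
  show "distr (lborel \<Otimes>\<^sub>M lborel) borel \<phi> = lborel"
  proof (rule lborel_eqI[symmetric])
    fix l u :: "real^2"
    assume "\<And>b. b \<in> Basis \<Longrightarrow> l \<bullet> b \<le> u \<bullet> b"
    then have lu: "l $ i \<le> u $ i" for i
      by (metis axis_in_Basis_iff Basis_real_def cart_eq_inner_axis insertI1)
    have B: "(\<Prod>b\<in>Basis. (u - l) \<bullet> b) = (u $ 1 - l $ 1) * (u $ 2 - l $ 2)"
    proof -
      have "(Basis :: (real^2) set) = {axis 1 1, axis 2 1}"
        by (auto simp: Basis_vec_def) (metis exhaust_2)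
      then have "(\<Prod>b\<in>Basis. (u - l) \<bullet> b) = (\<Prod>b\<in>{axis 1 1, axis 2 1}. (u - l) \<bullet> b)"
        by (rule arg_cong)
      also have "\<dots> = (u $ 1 - l $ 1) * (u $ 2 - l $ 2)"
        by (simp add: axis_eq_axis inner_axis)
      finally show ?thesis .
    qed
    have "emeasure (distr (lborel \<Otimes>\<^sub>M lborel) borel \<phi>) (box l u)
        = emeasure (lborel \<Otimes>\<^sub>M lborel) (\<phi> -` box l u)"
      using m by (subst emeasure_distr) (auto simp: lborel_prod)
    also have "\<dots> = ennreal ((u $ 1 - l $ 1) * (u $ 2 - l $ 2))"
    proof (rule disjE[OF \<phi>])
      assume "\<phi> = (\<lambda>(x, y). vector [x, y])"
      then have "\<phi> -` box l u = {l $ 1<..<u $ 1} \<times> {l $ 2<..<u $ 2}"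
        by (auto simp: mem_box_cart forall_2 vector_2)
      then show ?thesis
        using lu by (simp add: lborel.emeasure_pair_measure_Times ennreal_mult)
    next
      assume "\<phi> = (\<lambda>(x, y). vector [y, x])"
      then have "\<phi> -` box l u = {l $ 2<..<u $ 2} \<times> {l $ 1<..<u $ 1}"
        by (auto simp: mem_box_cart forall_2 vector_2)
      then show ?thesis
        using lu by (simp add: lborel.emeasure_pair_measure_Times ennreal_mult mult.commute)
    qed
    finally show "emeasure (distr (lborel \<Otimes>\<^sub>M lborel) borel \<phi>) (box l u) = ennreal (\<Prod>b\<in>Basis. (u - l) \<bullet> b)"
      by (simp add: B)
  qed simp
qed

text \<open>
  For fixed second coordinate \<open>s\<close> the slice of the triangle is \<open>{0..1 - s}\<close>, on which the fundamental
  theorem of calculus applies.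
\<close>

lemma ref_triangle_integral_slices:
  fixes \<phi> :: "real \<times> real \<Rightarrow> real^2" and p d :: "real^2 \<Rightarrow> real"
  assumes \<phi>: "\<phi> = (\<lambda>(x, y). vector [x, y]) \<or> \<phi> = (\<lambda>(x, y). vector [y, x])"
    and d: "continuous_on UNIV d"
    and p: "continuous_on UNIV p"
    and deriv: "\<And>x y. ((\<lambda>x. p (\<phi> (x, y))) has_real_derivative d (\<phi> (x, y))) (at x)"
  shows "(LINT x:ref_triangle|lborel. d x)
      = integral {0..1} (\<lambda>s. p (\<phi> (1 - s, s)) - p (\<phi> (0, s)))"
proof -
  have cont: "continuous_on UNIV \<phi>"
    using \<phi> by (auto simp: case_prod_unfold vector_2_axis intro!: continuous_intros)
  let ?f = "\<lambda>x. indicator ref_triangle x *\<^sub>R d x"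
  have ind: "indicator ref_triangle (\<phi> (x, y)) = (indicator {0..1} y * indicator {0..1 - y} x :: real)" for x y
    using \<phi> by (auto simp: ref_triangle_eq vector_2 split: split_indicator)
  have int: "integrable lborel ?f"
    using set_integrable_ref_triangle[of d] d continuous_on_subset
    unfolding set_integrable_def by blast
  then have int': "integrable (distr (lborel \<Otimes>\<^sub>M lborel) borel \<phi>) ?f"
    by (simp add: lborel_vec2(1)[OF \<phi>])
  have meas: "\<phi> \<in> measurable (lborel \<Otimes>\<^sub>M lborel) borel"
    using lborel_vec2(2)[OF \<phi>] by (simp add: lborel_prod)
  have fmeas: "?f \<in> borel_measurable borel" using int by (auto dest: borel_measurable_integrable)
  have "(LINT x:ref_triangle|lborel. d x) = integral\<^sup>L (distr (lborel \<Otimes>\<^sub>M lborel) borel \<phi>) ?f"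
    by (simp add: lborel_vec2(1)[OF \<phi>] set_lebesgue_integral_def)
  also have "\<dots> = integral\<^sup>L (lborel \<Otimes>\<^sub>M lborel) (\<lambda>(x, y). ?f (\<phi> (x, y)))"
    by (subst integral_distr[OF meas fmeas]) (simp add: case_prod_unfold)
  also have "\<dots> = (LINT y|lborel. (LINT x|lborel. ?f (\<phi> (x, y))))"
    using integrable_distr[OF meas int']
    by (subst lborel_pair.integral_snd) (simp_all add: case_prod_unfold)
  also have "\<dots> = (LINT y|lborel. indicator {0..1} y *\<^sub>R (p (\<phi> (1 - y, y)) - p (\<phi> (0, y))))"
  proof (rule Bochner_Integration.integral_cong[OF refl])
    fix y :: real
    show "(LINT x|lborel. ?f (\<phi> (x, y))) = indicator {0..1} y *\<^sub>R (p (\<phi> (1 - y, y)) - p (\<phi> (0, y)))"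
    proof (cases "y \<in> {0..1}")
      case True
      have "(LINT x|lborel. d (\<phi> (x, y)) * indicator {0..1 - y} x) = p (\<phi> (1 - y, y)) - p (\<phi> (0, y))"
      proof (rule integral_FTC_Icc_real)
        have "continuous_on UNIV (\<lambda>x. d (\<phi> (x, y)))"
          by (rule continuous_on_compose2[OF d continuous_on_compose2[OF cont]]) (auto intro!: continuous_intros)
        then show "isCont (\<lambda>x. d (\<phi> (x, y))) x" for x
          by (simp add: continuous_on_eq_continuous_at)
      qed (use True deriv in auto)
      then show ?thesis using True by (simp add: ind mult.commute)
    qed (simp add: ind)
  qed
  also have "\<dots> = integral {0..1} (\<lambda>s. p (\<phi> (1 - s, s)) - p (\<phi> (0, s)))"
  proof -
    have "continuous_on {0..1} (\<lambda>s. p (\<phi> (1 - s, s)) - p (\<phi> (0, s)))"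
      by (intro continuous_intros continuous_on_compose2[OF p continuous_on_compose2[OF cont]]) auto
    then have "set_integrable lborel {0..1} (\<lambda>s. p (\<phi> (1 - s, s)) - p (\<phi> (0, s)))"
      unfolding set_integrable_def by (intro borel_integrable_compact) auto
    from set_borel_integral_eq_integral(2)[OF this] show ?thesis
      by (simp add: set_lebesgue_integral_def)
  qed
  finally show ?thesis .
qed

section \<open>The divergence theorem on the reference triangle\<close>

definition det2 :: "real^2 \<Rightarrow> real^2 \<Rightarrow> real" where
  "det2 a b = a $ 1 * b $ 2 - a $ 2 * b $ 1"

text \<open>
  Integral of \<open>w\<close> against the edge vector \<open>b - a\<close> turned clockwise by a right angle. This is the outward
  flux through the edge if the triangle lies to the left of the way from \<open>a\<close> to \<open>b\<close>, and its negative
  otherwise.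
\<close>

definition edge_flux :: "(real^2 \<Rightarrow> real^2) \<Rightarrow> real^2 \<Rightarrow> real^2 \<Rightarrow> real" where
  "edge_flux w a b = integral {0..1} (\<lambda>s. det2 (w (a + s *\<^sub>R (b - a))) (b - a))"

lemma integral_0_1_reverse: "integral {0..1} (\<lambda>s::real. f (1 - s)) = integral {0..1} f"
  for f :: "real \<Rightarrow> real"
proof -
  have "integral {0..1} (\<lambda>s. f (1 - s)) = integral {-1..0} (\<lambda>s. f (s + 1))"
    using Henstock_Kurzweil_Integration.integral_reflect_real[of 1 0 "\<lambda>s. f (1 - s)"] by (simp add: add.commute)
  also have "\<dots> = integral {0..1} f"
    using integral_shift_real_ivl[of 0 1 1 f] by simp
  finally show ?thesis .
qed

lemma edge_flux_swap: "edge_flux w b a = - edge_flux w a b"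
proof -
  let ?f = "\<lambda>s. det2 (w (a + s *\<^sub>R (b - a))) (b - a)"
  have "edge_flux w b a = integral {0..1} (\<lambda>s. - ?f (1 - s))"
    unfolding edge_flux_def by (rule integral_cong) (simp add: det2_def algebra_simps)
  also have "\<dots> = - integral {0..1} (\<lambda>s. ?f (1 - s))" by simp
  also have "integral {0..1} (\<lambda>s. ?f (1 - s)) = integral {0..1} ?f"
    by (rule integral_0_1_reverse)
  finally show ?thesis by (simp add: edge_flux_def)
qed

lemma has_partials_continuous: "has_partials p d1 d2 \<Longrightarrow> continuous_on UNIV p"
  unfolding has_partials_def by (meson continuous_at_imp_continuous_on has_derivative_continuous)

lemma has_partials_slices:
  assumes "has_partials p d1 d2"
  shows "((\<lambda>x. p (vector [x, y])) has_real_derivative d1 (vector [x, y])) (at x)"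
    and "((\<lambda>y. p (vector [x, y])) has_real_derivative d2 (vector [x, y])) (at y)"
proof -
  have p: "(p has_derivative (\<lambda>h. h $ 1 * d1 (vector [x, y]) + h $ 2 * d2 (vector [x, y]))) (at (vector [x, y]))"
    using assms by (simp add: has_partials_def)
  have "((\<lambda>x::real. vector [x, y] :: real^2) has_derivative (\<lambda>h. h *\<^sub>R axis 1 1)) (at x)"
       "((\<lambda>y::real. vector [x, y] :: real^2) has_derivative (\<lambda>h. h *\<^sub>R axis 2 1)) (at y)"
    by (auto simp: vector_2_axis intro!: derivative_eq_intros)
  note has_derivative_compose[OF this(1) p] has_derivative_compose[OF this(2) p]
  then
  show "((\<lambda>x. p (vector [x, y])) has_real_derivative d1 (vector [x, y])) (at x)"
    "((\<lambda>y. p (vector [x, y])) has_real_derivative d2 (vector [x, y])) (at y)"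
    by (simp_all add: has_field_derivative_def axis_def mult_commute_abs)
qed

lemma divergence_ref_triangle:
  fixes w :: "real^2 \<Rightarrow> real^2"
  assumes w1: "has_partials (\<lambda>x. w x $ 1) d1 d1'" and w2: "has_partials (\<lambda>x. w x $ 2) d2' d2"
    and d: "continuous_on UNIV d1" "continuous_on UNIV d2"
  shows "(LINT x:ref_triangle|lborel. d1 x + d2 x)
    = edge_flux w (vector [1, 0]) (vector [0, 1]) + edge_flux w (vector [0, 1]) 0
      + edge_flux w 0 (vector [1, 0])"
proof -
  have cw: "continuous_on UNIV (\<lambda>x. w x $ 1)" "continuous_on UNIV (\<lambda>x. w x $ 2)"
    using w1 w2 by (auto dest: has_partials_continuous)
  have 1: "(LINT x:ref_triangle|lborel. d1 x)
      = integral {0..1} (\<lambda>s. w (vector [1 - s, s]) $ 1 - w (vector [0, s]) $ 1)"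
  proof -
    have "((\<lambda>x. w (vector [x, y]) $ 1) has_real_derivative d1 (vector [x, y])) (at x)" for x y
      using has_partials_slices w1 by blast
    then show ?thesis
      using ref_triangle_integral_slices[of "\<lambda>(x, y). vector [x, y]" d1 "\<lambda>x. w x $ 1"] d cw by simp
  qed
  have 2: "(LINT x:ref_triangle|lborel. d2 x)
      = integral {0..1} (\<lambda>s. w (vector [s, 1 - s]) $ 2 - w (vector [s, 0]) $ 2)"
  proof -
    have "((\<lambda>x. w (vector [y, x]) $ 2) has_real_derivative d2 (vector [y, x])) (at x)" for x y
      using has_partials_slices w2 by blast
    then show ?thesis
      using ref_triangle_integral_slices[of "\<lambda>(x, y). vector [y, x]" d2 "\<lambda>x. w x $ 2"] d cw by simp
  qed
  let ?u = "\<lambda>a s::real. w (a s) $ 1" and ?v = "\<lambda>a s::real. w (a s) $ 2"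
  let ?h = "\<lambda>s::real. vector [1 - s, s] :: real^2" and ?h' = "\<lambda>s::real. vector [s, 1 - s] :: real^2"
  let ?x = "\<lambda>s::real. vector [s, 0] :: real^2" and ?y = "\<lambda>s::real. vector [0, s] :: real^2"
  have int: "?u a integrable_on {0..1}" "?v a integrable_on {0..1}"
    if "continuous_on {0..1} a" for a :: "real \<Rightarrow> real^2"
    using that by (auto intro!: integrable_continuous_real
        continuous_on_compose2[OF cw(1)] continuous_on_compose2[OF cw(2)])
  have c: "continuous_on {0..1} ?h" "continuous_on {0..1} ?h'" "continuous_on {0..1} ?x" "continuous_on {0..1} ?y"
    by (auto simp: vector_2_axis intro!: continuous_intros)
  have hyp: "edge_flux w (vector [1, 0]) (vector [0, 1]) = integral {0..1} (?u ?h) + integral {0..1} (?v ?h)"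
  proof -
    have "vector [1, 0] + s *\<^sub>R (vector [0, 1] - vector [1, 0]) = ?h s" for s
      by (simp add: vec_eq_iff forall_2 vector_2)
    then show ?thesis
      by (simp add: edge_flux_def det2_def vector_2 int c Henstock_Kurzweil_Integration.integral_add)
  qed
  have left: "edge_flux w (vector [0, 1]) 0 = - integral {0..1} (?u ?y)"
  proof -
    have "vector [0, 1] + s *\<^sub>R (0 - vector [0, 1]) = ?y (1 - s)" for s
      by (simp add: vec_eq_iff forall_2 vector_2)
    then show ?thesis
      using integral_0_1_reverse[of "?u ?y"] by (simp add: edge_flux_def det2_def vector_2)
  qed
  have bottom: "edge_flux w 0 (vector [1, 0]) = - integral {0..1} (?v ?x)"
  proof -
    have "0 + s *\<^sub>R (vector [1, 0] - 0) = ?x s" for s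
      by (simp add: vec_eq_iff forall_2 vector_2)
    then show ?thesis by (simp add: edge_flux_def det2_def vector_2)
  qed
  have "(LINT x:ref_triangle|lborel. d1 x + d2 x)
      = (LINT x:ref_triangle|lborel. d1 x) + (LINT x:ref_triangle|lborel. d2 x)"
    using d by (intro set_integral_add) (auto intro!: set_integrable_ref_triangle intro: continuous_on_subset)
  also have "\<dots> = integral {0..1} (?u ?h) - integral {0..1} (?u ?y)
      + (integral {0..1} (?v ?h') - integral {0..1} (?v ?x))"
    by (simp add: 1 2 int c Henstock_Kurzweil_Integration.integral_diff)
  also have "integral {0..1} (?v ?h') = integral {0..1} (?v ?h)"
    using integral_0_1_reverse[of "?v ?h"] by simp
  finally show ?thesis by (simp add: hyp left bottom)
qed

section \<open>Curved triangles and the Piola transform\<close>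

text \<open>
  A curved triangle has no interior in space, so the inverse function theorem does not apply. The
  derivative of the parametrization is merely injective, and any left inverse of it is a derivative of
  the inverse parametrization relative to the surface. Compactness makes that inverse continuous,
  so that the linearization of \<open>G\<close> can be used near \<open>x\<close>.
\<close>

lemma has_derivative_left_inverse:
  fixes G :: "'a::euclidean_space \<Rightarrow> 'b::euclidean_space"
  assumes S: "compact S" "inj_on G S" "continuous_on S G" "x \<in> S"
    and G': "(G has_derivative G') (at x within S)"
    and L: "bounded_linear L" "\<And>h. L (G' h) = h"
  shows "(the_inv_into S G has_derivative L) (at (G x) within G ` S)"
  unfolding has_derivative_within_alt
proof (intro conjI allI impI)
  let ?g = "the_inv_into S G"
  interpret L: bounded_linear L by (rule L)
  obtain B where B: "B > 0" "\<And>z. norm (L z) \<le> norm z * B"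
    using L.pos_bounded by blast
  fix e :: real assume e: "e > 0"
  \<comment> \<open>the first bound makes the increment \<open>h\<close> below comparable to \<open>y - G x\<close>,
    the second one gives the error \<open>e\<close>\<close>
  define e' where "e' = min (1 / (2 * B)) (e / (2 * B\<^sup>2))"
  have e': "e' > 0" "B * e' \<le> 1 / 2" "B * e' * (2 * B) \<le> e"
    using B(1) e by (auto simp: e'_def min_def field_simps power2_eq_square)
  obtain d1 where d1: "d1 > 0"
    "\<And>y. y \<in> S \<Longrightarrow> norm (y - x) < d1 \<Longrightarrow> norm (G y - G x - G' (y - x)) \<le> e' * norm (y - x)"
    using G' e'(1) unfolding has_derivative_within_alt by blast
  have "continuous_on (G ` S) ?g"
    by (rule continuous_on_inv_into[OF S(3,1,2)])
  then obtain d where d: "d > 0" "\<And>y. y \<in> G ` S \<Longrightarrow> dist y (G x) < d \<Longrightarrow> dist (?g y) (?g (G x)) < d1"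
    using d1(1) S(4) unfolding continuous_on_iff by blast
  show "\<exists>d>0. \<forall>y\<in>G ` S. norm (y - G x) < d \<longrightarrow> norm (?g y - ?g (G x) - L (y - G x)) \<le> e * norm (y - G x)"
  proof (intro exI[of _ d] conjI ballI impI)
    fix y assume y: "y \<in> G ` S" "norm (y - G x) < d"
    define h where "h = ?g y - x"
    have gx: "?g (G x) = x" and gy: "?g y \<in> S" "G (?g y) = y"
      using S(2,4) y(1) by (auto simp: the_inv_into_f_f)
    have "norm h < d1"
      using d(2)[OF y(1)] y(2) gx by (simp add: h_def dist_norm)
    then have *: "norm (y - G x - G' h) \<le> e' * norm h"
      using d1(2)[OF gy(1)] gy(2) by (simp add: h_def)
    have Lh: "L (y - G x - G' h) = L (y - G x) - h" by (simp add: L.diff L(2))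
    have "norm (L (y - G x) - h) \<le> norm (y - G x - G' h) * B"
      using B(2)[of "y - G x - G' h"] by (simp add: Lh)
    also have "\<dots> \<le> B * e' * norm h"
      using mult_right_mono[OF *, of B] B(1) by (simp add: mult_ac)
    finally have 1: "norm (L (y - G x) - h) \<le> B * e' * norm h" .
    have "norm h \<le> norm (L (y - G x)) + norm (L (y - G x) - h)"
      by (metis norm_minus_commute norm_triangle_sub)
    also have "\<dots> \<le> B * norm (y - G x) + 1 / 2 * norm h"
      using B(2)[of "y - G x"] 1 mult_right_mono[OF e'(2), of "norm h"] by (simp add: mult_ac)
    finally have "norm h \<le> 2 * B * norm (y - G x)" by simp
    then have "B * e' * norm h \<le> B * e' * (2 * B * norm (y - G x))"
      using B(1) e'(1) by (intro mult_left_mono) auto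
    also have "\<dots> \<le> e * norm (y - G x)"
      using mult_right_mono[OF e'(3), of "norm (y - G x)"] by (simp add: mult_ac)
    finally show "norm (?g y - ?g (G x) - L (y - G x)) \<le> e * norm (y - G x)"
      using 1 by (simp add: gx h_def[symmetric] norm_minus_commute)
  qed (rule d(1))
qed (rule L(1))

lemma cross_parallel_normal:
  assumes "norm n = 1" "a \<bullet> n = 0" "b \<bullet> n = 0"
  shows "cross3 a b = (cross3 a b \<bullet> n) *\<^sub>R n"
proof -
  have nn: "n \<bullet> n = 1" using assms(1) by (simp add: dot_square_norm)
  have "cross3 n (cross3 a b) = 0"
    unfolding Lagrange using assms(2,3) by (simp add: inner_commute)
  then have "(n \<bullet> cross3 a b) *\<^sub>R n - (n \<bullet> n) *\<^sub>R cross3 a b = 0"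
    by (subst Lagrange[symmetric]) simp
  then show ?thesis by (simp add: nn inner_commute)
qed

text \<open>
  The trace of \<open>D\<close> restricted to the plane orthogonal to \<open>n\<close>, in terms of a basis \<open>a\<close>, \<open>b\<close> of that plane
  that need not be orthonormal. The coefficients come from the inverse of the Gram matrix, multiplied by
  its determinant.
\<close>

lemma tangential_trace:
  fixes D :: "real^3 \<Rightarrow> real^3"
  assumes D: "bounded_linear D" and n: "norm n = 1" "a \<bullet> n = 0" "b \<bullet> n = 0"
    and nz: "(a \<bullet> a) * (b \<bullet> b) - (a \<bullet> b)\<^sup>2 \<noteq> 0"
  shows "((a \<bullet> a) * (b \<bullet> b) - (a \<bullet> b)\<^sup>2) * (\<Sum>e\<in>Basis. D (e - (e \<bullet> n) *\<^sub>R n) \<bullet> e)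
    = (b \<bullet> b) * (D a \<bullet> a) - (a \<bullet> b) * (D a \<bullet> b) - (a \<bullet> b) * (D b \<bullet> a) + (a \<bullet> a) * (D b \<bullet> b)"
proof -
  interpret D: bounded_linear D by (rule D)
  let ?E = "a \<bullet> a" and ?F = "a \<bullet> b" and ?G = "b \<bullet> b"
  let ?\<Delta> = "?E * ?G - ?F\<^sup>2"
  have nn: "n \<bullet> n = 1" using n(1) by (simp add: dot_square_norm)
  let ?c = "cross3 a b"
  have "(norm ?c)\<^sup>2 = ?\<Delta>"
    using norm_cross_dot[of a b] by (simp add: power_mult_distrib power2_norm_eq_inner)
  then have c0: "?c \<noteq> 0" using nz by auto
  have cn: "?c = (?c \<bullet> n) *\<^sub>R n" by (rule cross_parallel_normal[OF n])
  have zero: "z = 0" if "z \<bullet> a = 0" "z \<bullet> b = 0" "z \<bullet> n = 0" for z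
  proof -
    have "cross3 z ?c = 0" using that by (simp add: Lagrange)
    moreover have "z \<bullet> ?c = 0" by (subst cn) (simp add: that)
    ultimately show ?thesis using norm_and_cross_eq_0[of z ?c] c0 by simp
  qed
  \<comment> \<open>Cramer's rule for the coordinates of the projection of \<open>e\<close> with respect to \<open>a\<close>, \<open>b\<close>\<close>
  have coord: "?\<Delta> *\<^sub>R (e - (e \<bullet> n) *\<^sub>R n)
      = ((e \<bullet> a) * ?G - (e \<bullet> b) * ?F) *\<^sub>R a + ((e \<bullet> b) * ?E - (e \<bullet> a) * ?F) *\<^sub>R b" for e
  proof -
    have "?\<Delta> *\<^sub>R (e - (e \<bullet> n) *\<^sub>R n)
      - (((e \<bullet> a) * ?G - (e \<bullet> b) * ?F) *\<^sub>R a + ((e \<bullet> b) * ?E - (e \<bullet> a) * ?F) *\<^sub>R b) = 0"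
      by (rule zero)
         (simp_all add: inner_diff_left inner_add_left n nn inner_commute[of n a] inner_commute[of n b] inner_commute[of b a]
           algebra_simps power2_eq_square)
    then show ?thesis by simp
  qed
  have dual: "(\<Sum>e\<in>Basis. (e \<bullet> u) * (w \<bullet> e)) = w \<bullet> u" for u w :: "real^3"
    by (subst (2) euclidean_inner) (simp add: inner_commute mult.commute)
  have "?\<Delta> * (\<Sum>e\<in>Basis. D (e - (e \<bullet> n) *\<^sub>R n) \<bullet> e)
      = (\<Sum>e\<in>Basis. D (?\<Delta> *\<^sub>R (e - (e \<bullet> n) *\<^sub>R n)) \<bullet> e)"
    by (simp add: sum_distrib_left D.scaleR)
  also have "\<dots> = (\<Sum>e\<in>Basis. ?G * ((e \<bullet> a) * (D a \<bullet> e)) - ?F * ((e \<bullet> b) * (D a \<bullet> e))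
      - ?F * ((e \<bullet> a) * (D b \<bullet> e)) + ?E * ((e \<bullet> b) * (D b \<bullet> e)))"
    unfolding coord D.add D.scaleR inner_add_left inner_scaleR_left
    by (rule sum.cong[OF refl]) (simp add: algebra_simps)
  also have "\<dots> = ?G * (D a \<bullet> a) - ?F * (D a \<bullet> b) - ?F * (D b \<bullet> a) + ?E * (D b \<bullet> b)"
    by (simp add: sum.distrib sum_subtractf flip: sum_distrib_left add: dual)
  finally show ?thesis .
qed

definition has_partials_within ::
    "(real^2) set \<Rightarrow> (real^2 \<Rightarrow> real^3) \<Rightarrow> (real^2 \<Rightarrow> real^3) \<Rightarrow> (real^2 \<Rightarrow> real^3) \<Rightarrow> bool" where
  "has_partials_within S f f1 f2 \<longleftrightarrow>
    (\<forall>x\<in>S. (f has_derivative (\<lambda>h. h $ 1 *\<^sub>R f1 x + h $ 2 *\<^sub>R f2 x)) (at x within S))"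

lemma has_partials_within_vec:
  fixes f :: "real^2 \<Rightarrow> real^3"
  assumes "\<And>i. has_partials (p i) (d i) (d' i)" "\<And>i x. x \<in> S \<Longrightarrow> f x $ i = p i x"
  shows "has_partials_within S f (\<lambda>x. \<chi> i. d i x) (\<lambda>x. \<chi> i. d' i x)"
  unfolding has_partials_within_def
proof
  fix x assume x: "x \<in> S"
  have "((\<lambda>x. f x $ i) has_derivative (\<lambda>h. h $ 1 * d i x + h $ 2 * d' i x)) (at x within S)" for i
    by (rule has_derivative_transform[OF x assms(2)])
       (use assms(1) in \<open>auto simp: has_partials_def intro: has_derivative_at_withinI\<close>)
  then show "(f has_derivative (\<lambda>h. h $ 1 *\<^sub>R (\<chi> i. d i x) + h $ 2 *\<^sub>R (\<chi> i. d' i x))) (at x within S)"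
    by (subst has_derivative_componentwise_within) (auto simp: Basis_vec_def inner_axis)
qed

lemma has_partials_within_continuous:
  "has_partials_within S f f1 f2 \<Longrightarrow> continuous_on S f"
  unfolding has_partials_within_def continuous_on_eq_continuous_within
  by (blast intro: has_derivative_continuous)

text \<open>
  A polynomial immersion of the closed reference triangle with a continuous unit normal. Which of the
  two unit normals \<open>\<nu>\<close> is, and whether \<open>G\<close> preserves the orientation, is left open; \<open>orientation\<close> shows
  that both choices enter through a single sign.
\<close>

locale curved_triangle =
  fixes G :: "real^2 \<Rightarrow> real^3" and \<nu> :: "real^3 \<Rightarrow> real^3" and k :: nat
  assumes polynomial: "\<And>i. \<exists>p\<in>poly_le k. \<forall>x\<in>ref_triangle. G x $ i = p x"
    and inj: "inj_on G ref_triangle"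
    and gram_pos: "x \<in> ref_triangle \<Longrightarrow> 0 < gram_det G x"
    and normal_continuous: "continuous_on (G ` ref_triangle) \<nu>"
    and normal_unit: "x \<in> ref_triangle \<Longrightarrow> norm (\<nu> (G x)) = 1"
    and normal_orthogonal: "x \<in> ref_triangle \<Longrightarrow> \<nu> (G x) \<bullet> D_ref G x w = 0"
begin

definition g1 where "g1 x = D_ref G x (axis 1 1)"
definition g2 where "g2 x = D_ref G x (axis 2 1)"

lemma partials:
  obtains g11 g12 g22 where
    "has_partials_within ref_triangle G g1 g2"
    "has_partials_within ref_triangle g1 g11 g12"
    "has_partials_within ref_triangle g2 g12 g22"
proof -
  have "\<forall>i. \<exists>p d1 d2 d11 d12 d22. (\<forall>x\<in>ref_triangle. G x $ i = p x) \<and>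
      has_partials p d1 d2 \<and> has_partials d1 d11 d12 \<and> has_partials d2 d12 d22"
  proof
    fix i
    obtain p where p: "p \<in> poly_le k" "\<forall>x\<in>ref_triangle. G x $ i = p x"
      using polynomial[of i] by blast
    from p(1) obtain d1 d2 d11 d12 d22 where
      "has_partials p d1 d2" "has_partials d1 d11 d12" "has_partials d2 d12 d22"
      by (rule poly_le_partials)
    with p(2) show "\<exists>p d1 d2 d11 d12 d22. (\<forall>x\<in>ref_triangle. G x $ i = p x) \<and>
      has_partials p d1 d2 \<and> has_partials d1 d11 d12 \<and> has_partials d2 d12 d22" by blast
  qed
  then obtain p d1 d2 d11 d12 d22 where p: "\<And>i x. x \<in> ref_triangle \<Longrightarrow> G x $ i = p i x"
    "\<And>i. has_partials (p i) (d1 i) (d2 i)" "\<And>i. has_partials (d1 i) (d11 i) (d12 i)"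
    "\<And>i. has_partials (d2 i) (d12 i) (d22 i)"
    by metis
  have G: "has_partials_within ref_triangle G (\<lambda>x. \<chi> i. d1 i x) (\<lambda>x. \<chi> i. d2 i x)"
    by (rule has_partials_within_vec[OF p(2,1)])
  have D: "D_ref G x = (\<lambda>h. h $ 1 *\<^sub>R (\<chi> i. d1 i x) + h $ 2 *\<^sub>R (\<chi> i. d2 i x))" if "x \<in> ref_triangle" for x
  proof (rule ref_triangle_derivative_unique[OF that])
    show "(G has_derivative (\<lambda>h. h $ 1 *\<^sub>R (\<chi> i. d1 i x) + h $ 2 *\<^sub>R (\<chi> i. d2 i x))) (at x within ref_triangle)"
      using G that unfolding has_partials_within_def by (rule bspec)
    then have "G differentiable (at x within ref_triangle)" by (rule differentiableI)
    then show "(G has_derivative D_ref G x) (at x within ref_triangle)"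
      by (rule iffD1[OF frechet_derivative_works])
  qed
  then have g: "g1 x $ i = d1 i x" "g2 x $ i = d2 i x" if "x \<in> ref_triangle" for x i
    using that by (simp_all add: g1_def g2_def axis_def)
  have "has_partials_within ref_triangle G g1 g2"
    using G D by (simp add: has_partials_within_def g1_def g2_def axis_def)
  then show thesis
    by (rule that[OF _ has_partials_within_vec[of d1 d11 d12, OF p(3) g(1)]
          has_partials_within_vec[of d2 d12 d22, OF p(4) g(2)]])
qed

lemma G_partials: "has_partials_within ref_triangle G g1 g2"
  by (rule partials)

lemma D_ref_works: "x \<in> ref_triangle \<Longrightarrow> (G has_derivative D_ref G x) (at x within ref_triangle)"
  by (rule iffD1[OF frechet_derivative_works], rule differentiableI,
      rule bspec[OF G_partials[unfolded has_partials_within_def]])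

lemma D_ref_eq: "x \<in> ref_triangle \<Longrightarrow> D_ref G x h = h $ 1 *\<^sub>R g1 x + h $ 2 *\<^sub>R g2 x"
  by (rule fun_cong[OF ref_triangle_derivative_unique[OF _ D_ref_works
        bspec[OF G_partials[unfolded has_partials_within_def]]]])

lemma continuous_G: "continuous_on ref_triangle G"
  using G_partials by (rule has_partials_within_continuous)

lemma continuous_g: "continuous_on ref_triangle g1" "continuous_on ref_triangle g2"
  using partials has_partials_within_continuous by metis+

lemma gram_det_eq: "gram_det G x = (g1 x \<bullet> g1 x) * (g2 x \<bullet> g2 x) - (g1 x \<bullet> g2 x)\<^sup>2"
proof -
  have "(transpose (matrix (D_ref G x)) ** matrix (D_ref G x)) $ i $ j
      = D_ref G x (axis i 1) \<bullet> D_ref G x (axis j 1)" for i j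
    by (simp add: matrix_matrix_mult_def transpose_def matrix_def inner_vec_def)
  then show ?thesis
    unfolding gram_det_def det_2 g1_def g2_def
    by (simp only: power2_eq_square inner_commute[of "D_ref G x (axis 2 1)" "D_ref G x (axis 1 1)"])
qed

lemma J_pos: "x \<in> ref_triangle \<Longrightarrow> 0 < J G x"
  by (simp add: J_def gram_pos)

lemma J_square: "x \<in> ref_triangle \<Longrightarrow> (J G x)\<^sup>2 = gram_det G x"
  using gram_pos[of x] by (simp add: J_def)

lemma continuous_J: "continuous_on ref_triangle (J G)"
  unfolding J_def[abs_def] gram_det_eq by (intro continuous_intros continuous_g)

lemma normal_g: "x \<in> ref_triangle \<Longrightarrow> g1 x \<bullet> \<nu> (G x) = 0" "x \<in> ref_triangle \<Longrightarrow> g2 x \<bullet> \<nu> (G x) = 0"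
  unfolding g1_def g2_def by (simp_all add: inner_commute[of "D_ref G x _"] normal_orthogonal)

text \<open>
  The vector \<open>g1 \<times> g2\<close> is normal of length \<open>J G\<close>, so its component along the unit normal is \<open>\<plusminus>J G\<close>. The sign
  depends continuously on the point of a connected set.
\<close>

lemma orientation:
  obtains \<sigma> where "\<sigma> = 1 \<or> \<sigma> = -1"
    "\<And>x. x \<in> ref_triangle \<Longrightarrow> cross3 (g1 x) (g2 x) \<bullet> \<nu> (G x) = \<sigma> * J G x"
proof -
  let ?f = "\<lambda>x. (cross3 (g1 x) (g2 x) \<bullet> \<nu> (G x)) / J G x"
  have abs: "?f x = 1 \<or> ?f x = -1" if x: "x \<in> ref_triangle" for x
  proof -
    let ?c = "cross3 (g1 x) (g2 x)" and ?n = "\<nu> (G x)"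
    have "?c = (?c \<bullet> ?n) *\<^sub>R ?n"
      by (rule cross_parallel_normal[OF normal_unit[OF x] normal_g[OF x]])
    then have "(norm ?c)\<^sup>2 = (?c \<bullet> ?n)\<^sup>2"
      using normal_unit[OF x] by (metis norm_scaleR mult.right_neutral power2_abs)
    moreover have "(norm ?c)\<^sup>2 = gram_det G x"
      using norm_cross_dot[of "g1 x" "g2 x"]
      by (simp add: gram_det_eq power_mult_distrib power2_norm_eq_inner)
    ultimately have "(?c \<bullet> ?n)\<^sup>2 = (J G x)\<^sup>2" using J_square[OF x] by simp
    then show ?thesis using J_pos[OF x] by (auto simp: power2_eq_iff)
  qed
  have "continuous_on ref_triangle ?f"
  proof (intro continuous_on_divide continuous_on_inner continuous_on_cross continuous_g continuous_J)
    show "continuous_on ref_triangle (\<lambda>x. \<nu> (G x))"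
      by (rule continuous_on_compose2[OF normal_continuous continuous_G]) auto
    show "\<forall>x\<in>ref_triangle. J G x \<noteq> 0" using J_pos by force
  qed
  then have "?f constant_on ref_triangle"
  proof (rule continuous_finite_range_constant[OF convex_connected[OF convex_ref_triangle]])
    show "finite (?f ` ref_triangle)"
      by (rule finite_subset[of _ "{1, -1}"]) (use abs in \<open>blast, simp\<close>)
  qed
  then obtain \<sigma> where \<sigma>: "\<And>x. x \<in> ref_triangle \<Longrightarrow> ?f x = \<sigma>" by (auto simp: constant_on_def)
  have "0 \<in> ref_triangle" by (simp add: ref_triangle_eq)
  then have "\<sigma> = 1 \<or> \<sigma> = -1" using abs[of 0] \<sigma>[of 0] by simp
  moreover have "cross3 (g1 x) (g2 x) \<bullet> \<nu> (G x) = \<sigma> * J G x" if "x \<in> ref_triangle" for x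
    using \<sigma>[OF that] J_pos[OF that] by (simp add: field_simps)
  ultimately show thesis using that by blast
qed

text \<open>
  The orientation sign of \<open>G\<close> relative to \<open>\<nu>\<close>, read off at the vertex \<open>0\<close>.
\<close>

definition \<sigma> :: real where
  "\<sigma> = cross3 (g1 0) (g2 0) \<bullet> \<nu> (G 0) / J G 0"

lemma sign: "\<sigma> = 1 \<or> \<sigma> = -1"
  and cross_g: "x \<in> ref_triangle \<Longrightarrow> cross3 (g1 x) (g2 x) \<bullet> \<nu> (G x) = \<sigma> * J G x"
proof -
  obtain \<tau> where \<tau>: "\<tau> = 1 \<or> \<tau> = -1"
    "\<And>x. x \<in> ref_triangle \<Longrightarrow> cross3 (g1 x) (g2 x) \<bullet> \<nu> (G x) = \<tau> * J G x"
    by (rule orientation) blast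
  have "0 \<in> ref_triangle" by (simp add: ref_triangle_eq)
  then have "\<sigma> = \<tau>" using \<tau>(2)[of 0] J_pos[of 0] by (simp add: \<sigma>_def)
  with \<tau> show "\<sigma> = 1 \<or> \<sigma> = -1"
    "x \<in> ref_triangle \<Longrightarrow> cross3 (g1 x) (g2 x) \<bullet> \<nu> (G x) = \<sigma> * J G x"
    by simp_all
qed

text \<open>
  Co-normal components on the surface are planar determinants on the reference triangle. This single
  identity gives both the flux density of a Piola transform (\<open>conormal_piola\<close>) and the side of an edge
  on which the element lies.
\<close>

lemma conormal_det2:
  assumes x: "x \<in> ref_triangle"
  shows "cross3 (D_ref G x t) (\<nu> (G x)) \<bullet> D_ref G x a = \<sigma> * J G x * det2 a t"
proof -
  have "cross3 (D_ref G x t) (\<nu> (G x)) \<bullet> D_ref G x a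
      = cross3 (D_ref G x a) (D_ref G x t) \<bullet> \<nu> (G x)"
    by (metis cross_triple)
  also have "cross3 (D_ref G x a) (D_ref G x t) = det2 a t *\<^sub>R cross3 (g1 x) (g2 x)"
    using cross_skew[of "g2 x" "g1 x"]
    by (simp add: D_ref_eq[OF x] cross_add_left cross_add_right cross_mult_left cross_mult_right
        det2_def scaleR_left_diff_distrib mult.commute)
  finally show ?thesis using cross_g[OF x] by simp
qed

lemma piola_eq:
  "x \<in> ref_triangle \<Longrightarrow> piola G w (G x) = inverse (J G x) *\<^sub>R D_ref G x (w x)"
  by (simp add: piola_def the_inv_into_f_f[OF inj] Let_def)

lemma conormal_piola:
  assumes x: "x \<in> ref_triangle"
  shows "cross3 (D_ref G x t) (\<nu> (G x)) \<bullet> piola G w (G x) = \<sigma> * det2 (w x) t"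
  using conormal_det2[OF x] J_pos[OF x] by (simp add: piola_eq[OF x])

text \<open>
  The Piola identity. In the tangential trace of the derivative of \<open>(w\<^sub>1 g\<^sub>1 + w\<^sub>2 g\<^sub>2) / J\<close> the derivatives
  of \<open>w\<close> contribute \<open>div w / J\<close>. The derivatives of \<open>g\<^sub>1\<close>, \<open>g\<^sub>2\<close> contribute, because second derivatives
  commute, \<open>1 / J\<close> times half the logarithmic derivative of the Gram determinant in the direction \<open>w\<close>,
  and this is exactly what the derivative of the factor \<open>1 / J\<close> takes away.
\<close>

lemma surf_div_piola:
  assumes w1: "has_partials (\<lambda>x. w x $ 1) d1 d1'" and w2: "has_partials (\<lambda>x. w x $ 2) d2' d2"
    and v: "\<And>x. x \<in> G ` ref_triangle \<Longrightarrow> v x = piola G w x"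
    and x: "x \<in> ref_triangle"
  shows "surf_div (G ` ref_triangle) \<nu> v (G x) * J G x = d1 x + d2 x"
proof -
  let ?S = ref_triangle
  obtain g11 g12 g22 where g: "has_partials_within ?S g1 g11 g12" "has_partials_within ?S g2 g12 g22"
    by (rule partials)
  let ?a = "g1 x" and ?b = "g2 x" and ?aa = "g11 x" and ?ab = "g12 x" and ?bb = "g22 x"
  let ?\<Delta> = "gram_det G x" and ?J = "J G x"
  have \<Delta>: "?\<Delta> > 0" using gram_pos[OF x] .
  have J: "?J > 0" "?J * ?J = ?\<Delta>" using J_pos[OF x] J_square[OF x] by (auto simp: power2_eq_square)
  define dg1 where "dg1 h = h $ 1 *\<^sub>R ?aa + h $ 2 *\<^sub>R ?ab" for h :: "real^2"
  define dg2 where "dg2 h = h $ 1 *\<^sub>R ?ab + h $ 2 *\<^sub>R ?bb" for h :: "real^2"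
  have dg: "(g1 has_derivative dg1) (at x within ?S)" "(g2 has_derivative dg2) (at x within ?S)"
    using g x unfolding has_partials_within_def dg1_def[abs_def] dg2_def[abs_def] by blast+
  define d\<Delta> where "d\<Delta> h = (?a \<bullet> ?a) * (2 * (?b \<bullet> dg2 h)) + (2 * (?a \<bullet> dg1 h)) * (?b \<bullet> ?b)
      - 2 * (?a \<bullet> ?b) * (?a \<bullet> dg2 h + dg1 h \<bullet> ?b)" for h
  have dgram: "(gram_det G has_derivative d\<Delta>) (at x within ?S)"
    unfolding gram_det_eq[abs_def] power2_eq_square
    by (rule has_derivative_eq_rhs[OF has_derivative_diff[OF
          has_derivative_mult[OF has_derivative_inner[OF dg(1,1)] has_derivative_inner[OF dg(2,2)]]
          has_derivative_mult[OF has_derivative_inner[OF dg] has_derivative_inner[OF dg]]]])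
       (simp add: d\<Delta>_def fun_eq_iff inner_commute[of "dg1 _" ?a] inner_commute[of "dg2 _" ?b] algebra_simps)
  define dJ where "dJ h = d\<Delta> h / (2 * ?J)" for h
  have dJ: "(J G has_derivative dJ) (at x within ?S)"
  proof -
    have "(sqrt has_derivative (*) (inverse (sqrt ?\<Delta>) / 2)) (at ?\<Delta>)"
      using DERIV_real_sqrt[OF \<Delta>] by (simp add: has_field_derivative_def)
    note has_derivative_compose[OF dgram this]
    moreover have "(\<lambda>h. inverse (sqrt ?\<Delta>) / 2 * d\<Delta> h) = dJ"
      unfolding dJ_def J_def by (rule ext) (simp add: field_simps)
    moreover have "J G = (\<lambda>x. sqrt (gram_det G x))" by (rule ext) (rule J_def)
    ultimately show ?thesis by (simp only:)
  qed
  define dw1 where "dw1 h = h $ 1 * d1 x + h $ 2 * d1' x" for h :: "real^2"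
  define dw2 where "dw2 h = h $ 1 * d2' x + h $ 2 * d2 x" for h :: "real^2"
  have dw: "((\<lambda>x. w x $ 1) has_derivative dw1) (at x within ?S)"
    "((\<lambda>x. w x $ 2) has_derivative dw2) (at x within ?S)"
    using w1 w2 unfolding has_partials_def dw1_def[abs_def] dw2_def[abs_def]
    by (blast intro: has_derivative_at_withinI)+
  define U where "U y = w y $ 1 *\<^sub>R g1 y + w y $ 2 *\<^sub>R g2 y" for y
  define dU where "dU h = (w x $ 1 *\<^sub>R dg1 h + dw1 h *\<^sub>R ?a) + (w x $ 2 *\<^sub>R dg2 h + dw2 h *\<^sub>R ?b)" for h
  have dU: "(U has_derivative dU) (at x within ?S)"
    unfolding U_def[abs_def] dU_def[abs_def]
    by (intro has_derivative_add has_derivative_scaleR dw dg)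
  define W where "W y = inverse (J G y) *\<^sub>R U y" for y
  define dW where "dW h = inverse ?J *\<^sub>R dU h + (- (inverse ?J * dJ h * inverse ?J)) *\<^sub>R U x" for h
  have dW: "(W has_derivative dW) (at x within ?S)"
    unfolding W_def[abs_def] dW_def[abs_def]
    by (rule has_derivative_scaleR[OF Deriv.has_derivative_inverse[OF _ dJ] dU]) (use J(1) in simp)
  have vW: "v (G y) = W y" if "y \<in> ?S" for y
    using that by (simp add: v piola_eq W_def U_def D_ref_eq)
  \<comment> \<open>\<open>v\<close> is differentiable relative to the surface, as the composition of \<open>W\<close> with the inverse
    parametrization; only then does the chosen derivative in \<open>surf_div\<close> carry information\<close>
  have "linear (D_ref G x)" using D_ref_works[OF x] by (rule has_derivative_linear)
  moreover have "inj (D_ref G x)"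
    unfolding linear_injective_0[OF \<open>linear (D_ref G x)\<close>]
  proof (intro allI impI)
    fix h assume h: "D_ref G x h = 0"
    have "cross3 (D_ref G x h) ?b = h $ 1 *\<^sub>R cross3 ?a ?b" "cross3 ?a (D_ref G x h) = h $ 2 *\<^sub>R cross3 ?a ?b"
      by (simp_all add: D_ref_eq[OF x] cross_add_left cross_add_right cross_mult_left cross_mult_right)
    moreover have "cross3 ?a ?b \<noteq> 0" using cross_g[OF x] J(1) sign by auto
    ultimately have "h $ 1 = 0" "h $ 2 = 0" using h by simp_all
    then show "h = 0" by (simp add: vec_eq_iff forall_2)
  qed
  ultimately obtain L where L: "linear L" "L \<circ> D_ref G x = id"
    using linear_injective_left_inverse by blast
  let ?g = "the_inv_into ?S G"
  have dinv: "(?g has_derivative L) (at (G x) within G ` ?S)"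
  proof (rule has_derivative_left_inverse[OF compact_ref_triangle inj continuous_G x D_ref_works[OF x]])
    show "bounded_linear L" using L(1) by (simp add: linear_conv_bounded_linear)
    show "L (D_ref G x h) = h" for h using L(2) by (metis comp_apply id_apply)
  qed
  have "((\<lambda>y. W (?g y)) has_derivative (\<lambda>h. dW (L h))) (at (G x) within G ` ?S)"
  proof (rule has_derivative_in_compose[OF dinv])
    have "?g ` G ` ?S = ?S" using the_inv_into_onto[OF inj] by simp
    moreover have "?g (G x) = x" using the_inv_into_f_f[OF inj x] .
    ultimately show "(W has_derivative dW) (at (?g (G x)) within ?g ` G ` ?S)" using dW by simp
  qed
  moreover have "v y = W (?g y)" if "y \<in> G ` ?S" for y
    using that vW inj by (auto simp: the_inv_into_f_f)
  ultimately have "(v has_derivative (\<lambda>h. dW (L h))) (at (G x) within G ` ?S)"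
    using x by (intro has_derivative_transform[of "G x" "G ` ?S" v "\<lambda>y. W (?g y)"]) auto
  then have "v differentiable (at (G x) within G ` ?S)" by (rule differentiableI)
  moreover define D where "D = frechet_derivative v (at (G x) within G ` ?S)"
  ultimately have D: "(v has_derivative D) (at (G x) within G ` ?S)"
    using frechet_derivative_works by blast
  \<comment> \<open>the chain rule determines this derivative on tangent vectors\<close>
  have "((\<lambda>y. v (G y)) has_derivative (\<lambda>h. D (D_ref G x h))) (at x within ?S)"
    by (rule has_derivative_in_compose[OF D_ref_works[OF x] D])
  then have "(W has_derivative (\<lambda>h. D (D_ref G x h))) (at x within ?S)"
    by (rule has_derivative_transform[OF x, rotated]) (simp add: vW)
  then have DW: "D (D_ref G x h) = dW h" for h
    using ref_triangle_derivative_unique[OF x _ dW] by metis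
  have Da: "D ?a = dW (axis 1 1)" and Db: "D ?b = dW (axis 2 1)"
    using DW[of "axis 1 1"] DW[of "axis 2 1"] by (simp_all add: g1_def g2_def)
  let ?E = "?a \<bullet> ?a" and ?F = "?a \<bullet> ?b" and ?G = "?b \<bullet> ?b"
  have "?\<Delta> * surf_div (G ` ?S) \<nu> v (G x)
      = ?G * (D ?a \<bullet> ?a) - ?F * (D ?a \<bullet> ?b) - ?F * (D ?b \<bullet> ?a) + ?E * (D ?b \<bullet> ?b)"
    unfolding surf_div_def tangent_proj_def D_def[symmetric] gram_det_eq
    by (rule tangential_trace[OF has_derivative_bounded_linear[OF D] normal_unit[OF x] normal_g[OF x]])
       (use \<Delta> gram_det_eq in simp)
  also have "\<dots> = inverse ?J * (?G * (dU (axis 1 1) \<bullet> ?a) - ?F * (dU (axis 1 1) \<bullet> ?b)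
        - ?F * (dU (axis 2 1) \<bullet> ?a) + ?E * (dU (axis 2 1) \<bullet> ?b))
      - inverse ?J * inverse ?J * (dJ (axis 1 1) * (?G * (U x \<bullet> ?a) - ?F * (U x \<bullet> ?b))
          + dJ (axis 2 1) * (?E * (U x \<bullet> ?b) - ?F * (U x \<bullet> ?a)))"
    unfolding Da Db dW_def by (simp add: inner_add_left inner_diff_left algebra_simps)
  also have "?G * (U x \<bullet> ?a) - ?F * (U x \<bullet> ?b) = ?\<Delta> * w x $ 1"
    by (simp add: U_def gram_det_eq inner_add_left inner_commute[of ?b ?a] power2_eq_square algebra_simps)
  also have "?E * (U x \<bullet> ?b) - ?F * (U x \<bullet> ?a) = ?\<Delta> * w x $ 2"
    by (simp add: U_def gram_det_eq inner_add_left inner_commute[of ?b ?a] power2_eq_square algebra_simps)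
  also have "inverse ?J * inverse ?J * (dJ (axis 1 1) * (?\<Delta> * w x $ 1) + dJ (axis 2 1) * (?\<Delta> * w x $ 2))
      = inverse ?J * (d\<Delta> (axis 1 1) * w x $ 1 + d\<Delta> (axis 2 1) * w x $ 2) / 2"
    unfolding dJ_def J(2)[symmetric] using J(1) by (simp add: field_simps)
  also have "?G * (dU (axis 1 1) \<bullet> ?a) - ?F * (dU (axis 1 1) \<bullet> ?b)
        - ?F * (dU (axis 2 1) \<bullet> ?a) + ?E * (dU (axis 2 1) \<bullet> ?b)
      = ?\<Delta> * (d1 x + d2 x) + (d\<Delta> (axis 1 1) * w x $ 1 + d\<Delta> (axis 2 1) * w x $ 2) / 2"
  proof -
    have comm: "?aa \<bullet> ?a = ?a \<bullet> ?aa" "?aa \<bullet> ?b = ?b \<bullet> ?aa" "?ab \<bullet> ?a = ?a \<bullet> ?ab"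
      "?ab \<bullet> ?b = ?b \<bullet> ?ab" "?bb \<bullet> ?a = ?a \<bullet> ?bb" "?bb \<bullet> ?b = ?b \<bullet> ?bb" "?b \<bullet> ?a = ?a \<bullet> ?b"
      by (rule inner_commute)+
    show ?thesis
      by (simp add: dU_def d\<Delta>_def dg1_def dg2_def dw1_def dw2_def axis_def gram_det_eq inner_add_left
          inner_add_right comm power2_eq_square field_simps)
  qed
  finally have "?\<Delta> * surf_div (G ` ?S) \<nu> v (G x) = inverse ?J * (?\<Delta> * (d1 x + d2 x))"
    by (simp add: algebra_simps)
  then have "?\<Delta> * (surf_div (G ` ?S) \<nu> v (G x) * ?J) = ?\<Delta> * (d1 x + d2 x)"
    using J(1) by (simp add: field_simps)
  then show ?thesis using \<Delta> by simp
qed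

end

section \<open>Edges of the Clough--Tocher refinement\<close>

lemma triangle_verts:
  assumes "2 simplex T"
  shows "card (verts T) = 3" "\<not> affine_dependent (verts T)" "T = convex hull (verts T)"
proof -
  obtain S where S: "\<not> affine_dependent S" "card S = 3" "T = convex hull S"
    using assms by (auto simp: simplex_def)
  then have "verts T = S"
    by (simp add: verts_def extreme_point_of_convex_hull_affine_independent)
  with S show "card (verts T) = 3" "\<not> affine_dependent (verts T)" "T = convex hull (verts T)"
    by simp_all
qed

lemma triangle_vertsE:
  assumes "2 simplex T" "x \<in> verts T"
  obtains y z where "verts T = {x, y, z}" "x \<noteq> y" "x \<noteq> z" "y \<noteq> z"
proof -
  have "finite (verts T)" "card (verts T) = 3"
    using triangle_verts(1)[OF assms(1)] by (auto intro: card_ge_0_finite)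
  then have "card (verts T - {x}) = 2" using assms(2) by simp
  then obtain y z where "verts T - {x} = {y, z}" "y \<noteq> z" by (auto simp: card_2_iff)
  then show thesis using assms(2) that[of y z] by (metis insert_Diff insertI1 insert_commute DiffE singletonI)
qed

definition ct_piece :: "(real^3) set \<Rightarrow> real^3 \<Rightarrow> (real^3) set" where
  "ct_piece T x = convex hull (insert (barycenter T) (verts T - {x}))"

lemma clough_tocher_eq: "clough_tocher \<T> = (\<Union>T\<in>\<T>. ct_piece T ` verts T)"
  by (simp add: clough_tocher_def ct_piece_def)

text \<open>
  The removed vertex is an affine combination of the barycenter and the other two vertices, so these
  three points are affinely independent as well, and all of them are extreme points.
\<close>

lemma ct_piece_verts:
  assumes T: "2 simplex T" and x: "x \<in> verts T"
  shows "verts (ct_piece T x) = insert (barycenter T) (verts T - {x})" (is ?verts)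
    and "card (verts (ct_piece T x)) = 3" and "barycenter T \<notin> verts T - {x}"
proof -
  obtain y z where yz: "verts T = {x, y, z}" "x \<noteq> y" "x \<noteq> z" "y \<noteq> z"
    using triangle_vertsE[OF assms] .
  let ?b = "barycenter T"
  have b: "?b = (1/3) *\<^sub>R (x + (y + z))" using yz by (simp add: barycenter_def)
  have "x = 3 *\<^sub>R ?b + (-1) *\<^sub>R y + (-1) *\<^sub>R z" by (simp add: b algebra_simps)
  moreover have "(3::real) + (-1) + (-1) = 1" by simp
  ultimately have "x \<in> affine hull {?b, y, z}"
    unfolding affine_hull_3 by blast
  then have "affine hull {x, y, z} \<subseteq> affine hull {?b, y, z}"
    by (intro hull_minimal) (auto simp: hull_inc)
  then have "aff_dim {x, y, z} \<le> aff_dim {?b, y, z}"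
    using aff_dim_subset[of "affine hull {x, y, z}" "affine hull {?b, y, z}"] by (simp add: aff_dim_affine_hull)
  moreover have "aff_dim {x, y, z} = 2"
    using triangle_verts(1,2)[OF T] unfolding yz(1) by (simp add: affine_independent_iff_card)
  moreover have "aff_dim {?b, y, z} \<le> int (card {?b, y, z}) - 1"
    by (rule aff_dim_le_card) simp
  moreover have "card {?b, y, z} \<le> 3" by (simp add: card_insert_if)
  ultimately have c: "card {?b, y, z} = 3" "aff_dim {?b, y, z} = int (card {?b, y, z}) - 1" by auto
  then have "\<not> affine_dependent {?b, y, z}" by (simp add: affine_independent_iff_card)
  moreover have d: "insert ?b (verts T - {x}) = {?b, y, z}" using yz by auto
  ultimately show v: ?verts
    by (auto simp: verts_def[of "convex hull _"] ct_piece_def extreme_point_of_convex_hull_affine_independent)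
  show "card (verts (ct_piece T x)) = 3" using v c(1) d by simp
  show "?b \<notin> verts T - {x}" using c(1) yz by (auto simp: card_insert_if split: if_splits)
qed

lemma barycenter_notin_verts:
  assumes T: "2 simplex T" shows "barycenter T \<notin> verts T"
proof
  assume b: "barycenter T \<in> verts T"
  then obtain y where "y \<in> verts T" "y \<noteq> barycenter T" using triangle_vertsE[OF T] by (metis insertCI)
  with ct_piece_verts(3)[OF T, of y] b show False by auto
qed

text \<open>
  The barycenter is a relative interior point, while distinct triangles of a triangulation meet in
  proper faces.
\<close>

lemma barycenter_in_unique_triangle:
  assumes \<T>: "triangulation \<T>" "\<And>T. T \<in> \<T> \<Longrightarrow> 2 simplex T"
    and T: "T \<in> \<T>" "T' \<in> \<T>" "barycenter T \<in> T'"
  shows "T = T'"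
proof -
  have simp: "2 simplex T" "2 simplex T'" using \<T>(2) T by auto
  have fin: "finite (verts T)" using triangle_verts(1)[OF simp(1)] by (auto intro: card_ge_0_finite)
  have "barycenter T \<in> rel_interior (convex hull (verts T))"
    unfolding rel_interior_convex_hull_explicit[OF triangle_verts(2)[OF simp(1)]]
    by (intro CollectI exI[of _ "\<lambda>_. 1/3"])
       (simp add: barycenter_def triangle_verts(1)[OF simp(1)] scaleR_sum_right)
  then have ri: "barycenter T \<in> rel_interior T" by (simp only: triangle_verts(3)[OF simp(1), symmetric])
  have face: "(T \<inter> T') face_of T" "(T' \<inter> T) face_of T'" using \<T>(1) T by (auto simp: triangulation_def)
  have "T \<inter> T' = T"
    using face_of_disjoint_rel_interior[OF face(1)] ri T(3) rel_interior_subset by blast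
  then have "T face_of T'" using face(2) by (simp add: Int_commute)
  moreover have "convex T'" by (subst triangle_verts(3)[OF simp(2)]) (rule convex_convex_hull)
  moreover have "aff_dim T = aff_dim T'" by (simp add: aff_dim_simplex[OF simp(1)] aff_dim_simplex[OF simp(2)])
  ultimately show ?thesis using face_of_aff_dim_lt[of T' T] by auto
qed

lemma edge_of_triangle_iff:
  assumes T: "2 simplex T" and "A \<noteq> B"
  shows "convex hull {A, B} edge_of T \<longleftrightarrow> A \<in> verts T \<and> B \<in> verts T"
proof
  assume "convex hull {A, B} edge_of T"
  then have f: "convex hull {A, B} face_of T" by (simp add: edge_of_def)
  have "A extreme_point_of convex hull {A, B}" "B extreme_point_of convex hull {A, B}"
    by (simp_all add: extreme_point_of_convex_hull_2)
  then show "A \<in> verts T \<and> B \<in> verts T"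
    using extreme_point_of_face[OF f, of A] extreme_point_of_face[OF f, of B]
    unfolding verts_def mem_Collect_eq by blast
next
  assume "A \<in> verts T \<and> B \<in> verts T"
  then have "convex hull {A, B} face_of convex hull (verts T)"
    unfolding face_of_convex_hull_affine_independent[OF triangle_verts(2)[OF T]]
    by (intro exI[of _ "{A, B}"]) simp
  then show "convex hull {A, B} edge_of T"
    unfolding triangle_verts(3)[OF T, symmetric] using assms(2) by (simp add: edge_of_def aff_dim_convex_hull aff_dim_2)
qed

text \<open>
  An edge from a barycenter to a vertex of \<open>T\<close> belongs to two of the three pieces of \<open>T\<close> and to no piece
  of another triangle. Any other edge is an edge of the original mesh; each of its two triangles
  contributes the piece opposite to the third vertex.
\<close>

lemma clough_tocher_edge:
  assumes \<T>: "closed_polyhedral_surface \<T>" and AB: "A \<noteq> B"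
    and ne: "{K \<in> clough_tocher \<T>. A \<in> verts K \<and> B \<in> verts K} \<noteq> {}"
  shows "\<exists>K K'. K \<noteq> K' \<and> {K \<in> clough_tocher \<T>. A \<in> verts K \<and> B \<in> verts K} = {K, K'}"
proof -
  have tri: "triangulation \<T>" and s: "\<And>T. T \<in> \<T> \<Longrightarrow> 2 simplex T"
    and two: "\<And>T e. T \<in> \<T> \<Longrightarrow> e edge_of T \<Longrightarrow> card {T'\<in>\<T>. e edge_of T'} = 2"
    using \<T> by (auto simp: closed_polyhedral_surface_def)
  have sub: "verts T \<subseteq> T" for T by (auto simp: verts_def extreme_point_of_def)
  have bary: "barycenter T \<in> T" if "T \<in> \<T>" for T
  proof -
    have "finite (verts T)" using triangle_verts(1)[OF s[OF that]] by (auto intro: card_ge_0_finite)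
    then have "(\<Sum>x\<in>verts T. (1/3) *\<^sub>R x) \<in> convex hull verts T"
      using triangle_verts(1)[OF s[OF that]]
      by (intro convex_sum convex_convex_hull) (auto simp: hull_inc)
    then show ?thesis
      using triangle_verts(3)[OF s[OF that], symmetric] by (simp add: barycenter_def scaleR_sum_right)
  qed
  \<comment> \<open>a barycenter occurs as a vertex of pieces of its own triangle only\<close>
  have uniq: "T = T'" if "T \<in> \<T>" "T' \<in> \<T>" "barycenter T \<in> insert (barycenter T') (verts T')" for T T'
    using barycenter_in_unique_triangle[OF tri s that(1,2)] that(3) bary[OF that(2)] sub[of T'] by auto
  have central: "\<exists>K K'. K \<noteq> K' \<and> {K \<in> clough_tocher \<T>. A \<in> verts K \<and> B \<in> verts K} = {K, K'}"
    if T: "T \<in> \<T>" and A: "A = barycenter T" and "A \<noteq> B"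
      and ne: "{K \<in> clough_tocher \<T>. A \<in> verts K \<and> B \<in> verts K} \<noteq> {}" for A B T
  proof -
    let ?M = "{K \<in> clough_tocher \<T>. A \<in> verts K \<and> B \<in> verts K}"
    have M: "?M = ct_piece T ` {x \<in> verts T. B \<in> verts T - {x}}"
    proof (intro equalityI subsetI)
      fix K assume K: "K \<in> ?M"
      then obtain T' x where T': "T' \<in> \<T>" "x \<in> verts T'" "K = ct_piece T' x"
        by (auto simp: clough_tocher_eq)
      then have v: "verts K = insert (barycenter T') (verts T' - {x})"
        using ct_piece_verts(1)[OF s] by simp
      then have "T = T'" using uniq[OF T T'(1)] K A by auto
      then show "K \<in> ct_piece T ` {x \<in> verts T. B \<in> verts T - {x}}"
        using T' v K A \<open>A \<noteq> B\<close> by auto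
    next
      fix K assume "K \<in> ct_piece T ` {x \<in> verts T. B \<in> verts T - {x}}"
      then show "K \<in> ?M"
        using T A ct_piece_verts(1)[OF s[OF T]] by (auto simp: clough_tocher_eq)
    qed
    then have "B \<in> verts T" using ne by auto
    then obtain y z where yz: "verts T = {B, y, z}" "B \<noteq> y" "B \<noteq> z" "y \<noteq> z"
      using triangle_vertsE[OF s[OF T]] by metis
    then have "{x \<in> verts T. B \<in> verts T - {x}} = {y, z}" by auto
    then have pieces: "?M = {ct_piece T y, ct_piece T z}" using M by simp
    have distinct: "ct_piece T y \<noteq> ct_piece T z"
    proof
      assume "ct_piece T y = ct_piece T z"
      then have "insert (barycenter T) (verts T - {y}) = insert (barycenter T) (verts T - {z})"
        using ct_piece_verts(1)[OF s[OF T], of y] ct_piece_verts(1)[OF s[OF T], of z] yz(1) by auto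
      moreover have "y \<in> insert (barycenter T) (verts T - {z})" using yz by simp
      ultimately have "y \<in> insert (barycenter T) (verts T - {y})" by (simp only:)
      then have "y = barycenter T" by simp
      moreover have "y \<in> verts T" using yz(1) by simp
      ultimately show False using barycenter_notin_verts[OF s[OF T]] by simp
    qed
    show ?thesis by (rule exI, rule exI, rule conjI, rule distinct, rule pieces)
  qed
  let ?M = "{K \<in> clough_tocher \<T>. A \<in> verts K \<and> B \<in> verts K}"
  consider (A) T where "T \<in> \<T>" "A = barycenter T" | (B) T where "T \<in> \<T>" "B = barycenter T"
    | (outer) "\<And>T. T \<in> \<T> \<Longrightarrow> A \<noteq> barycenter T" "\<And>T. T \<in> \<T> \<Longrightarrow> B \<noteq> barycenter T"
    by blast
  then show ?thesis
  proof cases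
    case A
    then show ?thesis using central[OF A AB ne] by blast
  next
    case B
    then show ?thesis using central[OF B AB[symmetric]] ne by (simp add: conj_commute)
  next
    case outer
    let ?S = "{T\<in>\<T>. A \<in> verts T \<and> B \<in> verts T}"
    have piece: "\<exists>x\<in>verts T. verts T = {A, B, x} \<and> x \<noteq> A \<and> x \<noteq> B" if "T \<in> ?S" for T
    proof -
      obtain y z where "verts T = {A, y, z}" "A \<noteq> y" "A \<noteq> z" "y \<noteq> z"
        using triangle_vertsE[OF s, of T A] \<open>T \<in> ?S\<close> by blast
      then show ?thesis using that AB by auto
    qed
    have M: "K \<in> ?M \<longleftrightarrow> (\<exists>T\<in>?S. \<exists>x\<in>verts T. x \<noteq> A \<and> x \<noteq> B \<and> K = ct_piece T x)" for K
    proof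
      assume K: "K \<in> ?M"
      then obtain T x where T: "T \<in> \<T>" "x \<in> verts T" "K = ct_piece T x"
        by (auto simp: clough_tocher_eq)
      then show "\<exists>T\<in>?S. \<exists>x\<in>verts T. x \<noteq> A \<and> x \<noteq> B \<and> K = ct_piece T x"
        using K ct_piece_verts(1)[OF s T(2)] outer[of T] by auto
    next
      assume "\<exists>T\<in>?S. \<exists>x\<in>verts T. x \<noteq> A \<and> x \<noteq> B \<and> K = ct_piece T x"
      then show "K \<in> ?M" using ct_piece_verts(1)[OF s] by (auto simp: clough_tocher_eq)
    qed
    then obtain T0 where T0: "T0 \<in> ?S" using ne by blast
    have "?S = {T\<in>\<T>. convex hull {A, B} edge_of T}"
      using edge_of_triangle_iff[OF s AB] by blast
    then have "card ?S = 2"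
      using two[of T0 "convex hull {A, B}"] T0 by simp
    then obtain T T' where TT: "?S = {T, T'}" "T \<noteq> T'" by (auto simp: card_2_iff)
    obtain x x' where x: "x \<in> verts T" "verts T = {A, B, x}" "x \<noteq> A" "x \<noteq> B"
      "x' \<in> verts T'" "verts T' = {A, B, x'}" "x' \<noteq> A" "x' \<noteq> B"
      using piece[of T] piece[of T'] TT by blast
    have pieces: "?M = {ct_piece T x, ct_piece T' x'}"
      unfolding set_eq_iff M TT(1) using x by auto
    have distinct: "ct_piece T x \<noteq> ct_piece T' x'"
    proof
      have T: "T \<in> \<T>" "T' \<in> \<T>" using TT(1) by auto
      assume "ct_piece T x = ct_piece T' x'"
      then have "barycenter T \<in> insert (barycenter T') (verts T' - {x'})"
        using ct_piece_verts(1)[OF s[OF T(1)] x(1)] ct_piece_verts(1)[OF s[OF T(2)] x(5)] by auto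
      then show False using uniq[OF T] TT(2) by auto
    qed
    show ?thesis by (rule exI, rule exI, rule conjI, rule distinct, rule pieces)
  qed
qed

lemma clough_tocher_card_verts:
  assumes "closed_polyhedral_surface \<T>" "K \<in> clough_tocher \<T>"
  shows "card (verts K) = 3"
  using assms ct_piece_verts(2) by (auto simp: closed_polyhedral_surface_def clough_tocher_eq)

lemma finite_clough_tocher:
  assumes "closed_polyhedral_surface \<T>"
  shows "finite (clough_tocher \<T>)"
proof -
  have "finite \<T>" "\<And>T. T \<in> \<T> \<Longrightarrow> finite (verts T)"
    using assms triangle_verts(1)
    by (auto simp: closed_polyhedral_surface_def triangulation_def intro!: card_ge_0_finite)
  then show ?thesis by (simp add: clough_tocher_eq)
qed

text \<open>
  Each element contributes its edges as ordered pairs of vertices, so every edge is counted twice per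
  element. This avoids the choice of a direction and does no harm to a sum that vanishes.
\<close>

lemma sum_over_edges_cancel:
  fixes \<phi> :: "(real^3) set \<Rightarrow> real^3 \<Rightarrow> real^3 \<Rightarrow> real"
  assumes \<T>: "closed_polyhedral_surface \<T>"
    and cancel: "\<And>K K' A B. K \<in> clough_tocher \<T> \<Longrightarrow> K' \<in> clough_tocher \<T> \<Longrightarrow> K \<noteq> K' \<Longrightarrow> A \<noteq> B \<Longrightarrow>
      {A, B} \<subseteq> verts K \<Longrightarrow> {A, B} \<subseteq> verts K' \<Longrightarrow> \<phi> K A B + \<phi> K' A B = 0"
  shows "(\<Sum>K\<in>clough_tocher \<T>. \<Sum>A\<in>verts K. \<Sum>B\<in>verts K - {A}. \<phi> K A B) = 0"
proof -
  let ?K = "clough_tocher \<T>"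
  define V where "V = (\<Union>K\<in>?K. verts K)"
  have fin: "finite ?K" by (rule finite_clough_tocher[OF \<T>])
  have finv: "finite (verts K)" if "K \<in> ?K" for K
    using clough_tocher_card_verts[OF \<T> that] by (auto intro: card_ge_0_finite)
  have finV: "finite V" using fin finv by (auto simp: V_def)
  have 1: "(\<Sum>A\<in>verts K. \<Sum>B\<in>verts K - {A}. \<phi> K A B)
      = (\<Sum>A\<in>V. \<Sum>B\<in>V. if A \<noteq> B \<and> A \<in> verts K \<and> B \<in> verts K then \<phi> K A B else 0)" if "K \<in> ?K" for K
  proof -
    have sub: "verts K \<subseteq> V" using that by (auto simp: V_def)
    have "(\<Sum>A\<in>verts K. \<Sum>B\<in>verts K - {A}. \<phi> K A B)
        = (\<Sum>A\<in>verts K. \<Sum>B\<in>V. if A \<noteq> B \<and> A \<in> verts K \<and> B \<in> verts K then \<phi> K A B else 0)"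
      using sub finV by (intro sum.cong[OF refl] sum.mono_neutral_cong_left) auto
    also have "\<dots> = (\<Sum>A\<in>V. \<Sum>B\<in>V. if A \<noteq> B \<and> A \<in> verts K \<and> B \<in> verts K then \<phi> K A B else 0)"
      using sub finV by (intro sum.mono_neutral_left) auto
    finally show ?thesis .
  qed
  have 2: "(\<Sum>K\<in>?K. if A \<noteq> B \<and> A \<in> verts K \<and> B \<in> verts K then \<phi> K A B else 0) = 0" for A B
  proof (cases "A \<noteq> B \<and> {K \<in> ?K. A \<in> verts K \<and> B \<in> verts K} \<noteq> {}")
    case True
    then obtain K K' where KK: "K \<noteq> K'" "{K \<in> ?K. A \<in> verts K \<and> B \<in> verts K} = {K, K'}"
      using clough_tocher_edge[OF \<T>] by meson
    have "(\<Sum>K\<in>?K. if A \<noteq> B \<and> A \<in> verts K \<and> B \<in> verts K then \<phi> K A B else 0)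
        = (\<Sum>K\<in>{K \<in> ?K. A \<in> verts K \<and> B \<in> verts K}. \<phi> K A B)"
      using True fin by (subst sum.inter_filter) auto
    also have "\<dots> = \<phi> K A B + \<phi> K' A B" using KK by simp
    also have "\<dots> = 0" using KK True by (intro cancel) auto
    finally show ?thesis .
  next
    case False
    then show ?thesis by (intro sum.neutral) auto
  qed
  have "(\<Sum>K\<in>?K. \<Sum>A\<in>verts K. \<Sum>B\<in>verts K - {A}. \<phi> K A B)
      = (\<Sum>K\<in>?K. \<Sum>A\<in>V. \<Sum>B\<in>V. if A \<noteq> B \<and> A \<in> verts K \<and> B \<in> verts K then \<phi> K A B else 0)"
    by (rule sum.cong[OF refl 1])
  also have "\<dots> = (\<Sum>A\<in>V. \<Sum>K\<in>?K. \<Sum>B\<in>V. if A \<noteq> B \<and> A \<in> verts K \<and> B \<in> verts K then \<phi> K A B else 0)"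
    by (rule sum.swap)
  also have "\<dots> = (\<Sum>A\<in>V. \<Sum>B\<in>V. \<Sum>K\<in>?K. if A \<noteq> B \<and> A \<in> verts K \<and> B \<in> verts K then \<phi> K A B else 0)"
    by (intro sum.cong[OF refl] sum.swap)
  also have "\<dots> = 0" by (simp only: 2 sum.neutral_const)
  finally show ?thesis .
qed

section \<open>Oriented edges of the reference triangle\<close>

definition ref_verts :: "(real^2) set" where
  "ref_verts = {vector [1, 0], vector [0, 1], 0}"

lemma ref_triangle_hull: "ref_triangle = convex hull ref_verts"
  by (simp add: ref_triangle_def ref_verts_def)

text \<open>
  The third vertex: the vertices of the reference triangle sum up to \<open>vector [1, 1]\<close>.
\<close>

definition opposite :: "real^2 \<Rightarrow> real^2 \<Rightarrow> real^2" where
  "opposite a b = vector [1, 1] - a - b"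

text \<open>
  Twice the signed area of the triangle with vertices \<open>a\<close>, \<open>b\<close> and the third vertex, hence \<open>1\<close> if \<open>a\<close>, \<open>b\<close>
  follow the counterclockwise order and \<open>-1\<close> otherwise.
\<close>

definition orient :: "real^2 \<Rightarrow> real^2 \<Rightarrow> real" where
  "orient a b = det2 (b - a) (opposite a b - a)"

lemma ref_verts_distinct: "vector [1, 0] \<noteq> (vector [0, 1] :: real^2)" "vector [1, 0] \<noteq> (0 :: real^2)"
  "vector [0, 1] \<noteq> (0 :: real^2)"
  by (simp_all add: vec_eq_iff forall_2 vector_2)

lemma orient_simps:
  "orient (vector [1, 0]) (vector [0, 1]) = 1" "orient (vector [0, 1]) (vector [1, 0]) = -1"
  "orient (vector [0, 1]) 0 = 1" "orient 0 (vector [0, 1]) = -1"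
  "orient 0 (vector [1, 0]) = 1" "orient (vector [1, 0]) 0 = -1"
  by (simp_all add: orient_def opposite_def det2_def vector_2)

lemma orient_sign:
  "a \<in> ref_verts \<Longrightarrow> b \<in> ref_verts \<Longrightarrow> a \<noteq> b \<Longrightarrow> orient a b = 1 \<or> orient a b = -1"
  by (auto simp: ref_verts_def orient_simps)

lemma opposite_in_ref_verts:
  "a \<in> ref_verts \<Longrightarrow> b \<in> ref_verts \<Longrightarrow> a \<noteq> b \<Longrightarrow> ref_verts = {a, b, opposite a b}"
  by (auto simp: ref_verts_def opposite_def vec_eq_iff forall_2 vector_2)

lemma sum_edge_flux:
  "(\<Sum>a\<in>ref_verts. \<Sum>b\<in>ref_verts - {a}. orient a b * edge_flux w a b)
    = 2 * (edge_flux w (vector [1, 0]) (vector [0, 1]) + edge_flux w (vector [0, 1]) 0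
      + edge_flux w 0 (vector [1, 0]))"
proof -
  note d = ref_verts_distinct ref_verts_distinct[symmetric]
  have "ref_verts - {vector [1, 0]} = {vector [0, 1], 0}" "ref_verts - {vector [0, 1]} = {vector [1, 0], 0}"
    "ref_verts - {0} = {vector [1, 0], vector [0, 1]}"
    using d by (auto simp: ref_verts_def)
  moreover have "(\<Sum>a\<in>ref_verts. f a) = f (vector [1, 0]) + f (vector [0, 1]) + f 0" for f :: "real^2 \<Rightarrow> real"
    unfolding ref_verts_def using d by simp
  ultimately show ?thesis
    using d edge_flux_swap[of w "vector [0, 1]" "vector [1, 0]"] edge_flux_swap[of w 0 "vector [0, 1]"]
      edge_flux_swap[of w "vector [1, 0]" 0]
    by (simp add: orient_simps)
qed

text \<open>
  The extreme points of an affine image of the triangle are among the images of the three vertices,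
  and by the cardinality of \<open>verts K\<close> none is missing.
\<close>

lemma affine_image_verts:
  fixes F :: "real^2 \<Rightarrow> real^3"
  assumes lin: "linear (\<lambda>x. F x - F 0)" and bij: "bij_betw F ref_triangle K" and c: "card (verts K) = 3"
  shows "verts K = F ` ref_verts"
proof -
  let ?L = "\<lambda>x. F x - F 0"
  have "K = F ` (convex hull ref_verts)" using bij by (simp add: bij_betw_def ref_triangle_hull)
  also have "\<dots> = (\<lambda>x. F 0 + x) ` ?L ` (convex hull ref_verts)" by (simp add: image_image)
  also have "?L ` (convex hull ref_verts) = convex hull (?L ` ref_verts)"
    by (rule convex_hull_linear_image[OF lin])
  also have "(\<lambda>x. F 0 + x) ` (convex hull (?L ` ref_verts)) = convex hull ((\<lambda>x. F 0 + x) ` ?L ` ref_verts)"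
    by (rule convex_hull_translation[symmetric])
  also have "(\<lambda>x. F 0 + x) ` ?L ` ref_verts = F ` ref_verts" by (simp add: image_image)
  finally have K: "K = convex hull (F ` ref_verts)" .
  have sub: "verts K \<subseteq> F ` ref_verts"
    unfolding verts_def K using extreme_point_of_convex_hull by blast
  have fin: "finite ref_verts" "card ref_verts \<le> 3" by (simp_all add: ref_verts_def card_insert_if)
  then have "card (F ` ref_verts) \<le> 3" using card_image_le[of ref_verts F] by linarith
  with c sub fin(1) show ?thesis by (intro card_seteq) auto
qed

section \<open>Flux balance of a discrete velocity\<close>

lemma differentiable_componentwise_vec:
  fixes f :: "'a::real_normed_vector \<Rightarrow> real^'n"
  assumes "\<And>i. (\<lambda>y. f y $ i) differentiable (at x within S)"
  shows "f differentiable (at x within S)"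
  by (subst differentiable_componentwise_within) (use assms in \<open>auto simp: Basis_vec_def inner_axis\<close>)

text \<open>
  The right-hand side does not contain \<open>n\<close>: this is why the nodal coupling makes co-normal components
  match across an edge.
\<close>

lemma node_transfer_conormal:
  assumes "norm n = 1" "n \<bullet> t = 0"
  shows "cross3 t n \<bullet> node_transfer n0 n w = - (cross3 w n0 \<bullet> t)"
proof -
  have nn: "n \<bullet> n = 1" using assms(1) by (simp add: dot_square_norm)
  have "node_transfer n0 n w = cross3 n (cross3 w n0)"
    by (simp add: node_transfer_def Lagrange inner_commute)
  then have "cross3 t n \<bullet> node_transfer n0 n w = cross3 (cross3 t n) n \<bullet> cross3 w n0"
    by (metis cross_triple inner_commute)
  also have "cross3 (cross3 t n) n = - t"
    using assms(2) cross_skew[of "cross3 t n" n] by (simp add: Lagrange nn inner_commute)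
  finally show ?thesis by (simp add: inner_commute)
qed

text \<open>
  The setting in which the fluxes of a fixed discrete velocity balance. From here on a field on an
  element is handled through the vector field \<open>w K\<close> on the reference triangle that it is the Piola
  transform of, and the vertices of an element through their preimages \<open>coord K\<close>.
\<close>

locale scott_vogelius_velocity =
  fixes C :: real and k r :: nat and \<Omega> \<Omega>\<^sub>h N :: "(real^3) set" and \<T> \<K> :: "(real^3) set set"
    and F :: "(real^3) set \<Rightarrow> real^2 \<Rightarrow> real^3" and \<Psi> :: "real^3 \<Rightarrow> real^3"
    and \<nu> v :: "(real^3) set \<Rightarrow> real^3 \<Rightarrow> real^3" and Ka :: "real^3 \<Rightarrow> (real^3) set"
  assumes C: "C > 0"
    and closed: "closed_polyhedral_surface \<T>"
    and \<K>: "\<K> = clough_tocher \<T>"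
    and surface: "high_order_surface C k \<Omega> \<T> F \<Psi> \<Omega>\<^sub>h \<nu>"
    and r: "r \<ge> 1"
    and nodes: "lagrange_nodes r \<K> N"
    and v: "v \<in> V_h r \<K> F \<Psi> \<nu> N Ka"
begin

abbreviation G where "G K \<equiv> \<Psi> \<circ> F K"

lemma F_affine: "K \<in> \<K> \<Longrightarrow> linear (\<lambda>x. F K x - F K 0)"
  and F_bij: "K \<in> \<K> \<Longrightarrow> bij_betw (F K) ref_triangle K"
  using surface by (auto simp: high_order_surface_def affine_param_def \<K> Let_def)

lemma G_image: "K \<in> \<K> \<Longrightarrow> G K ` ref_triangle = \<Psi> ` K"
  by (simp only: image_comp[symmetric] bij_betw_imp_surj_on[OF F_bij])

lemma card_verts: "K \<in> \<K> \<Longrightarrow> card (verts K) = 3"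
  using clough_tocher_card_verts[OF closed] \<K> by simp

lemma verts_eq: "K \<in> \<K> \<Longrightarrow> verts K = F K ` ref_verts"
  by (rule affine_image_verts[OF F_affine F_bij card_verts])

lemma element:
  assumes K: "K \<in> \<K>"
  shows "curved_triangle (G K) (\<nu> K) k"
proof
  have param: "curved_param C k (diameter K) (\<nu> K) (G K)"
    using surface K by (auto simp: high_order_surface_def \<K> Let_def)
  have normal: "continuous_on (\<Psi> ` K) (\<nu> K)"
    "\<And>x. x \<in> ref_triangle \<Longrightarrow> norm (\<nu> K (\<Psi> (F K x))) = 1"
    "\<And>x w. x \<in> ref_triangle \<Longrightarrow> \<nu> K (\<Psi> (F K x)) \<bullet> D_ref (G K) x w = 0"
    using surface K by (auto simp: high_order_surface_def outward_unit_normal_def \<K> Let_def)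
  show "inj_on (G K) ref_triangle" using param by (simp add: curved_param_def)
  show "\<exists>p\<in>poly_le k. \<forall>x\<in>ref_triangle. G K x $ i = p x" for i
    using param unfolding curved_param_def by blast
  show "continuous_on (G K ` ref_triangle) (\<nu> K)" using normal(1) G_image[OF K] by simp
  show "x \<in> ref_triangle \<Longrightarrow> norm (\<nu> K (G K x)) = 1" for x using normal(2) by simp
  show "x \<in> ref_triangle \<Longrightarrow> \<nu> K (G K x) \<bullet> D_ref (G K) x w = 0" for x w using normal(3) by simp
  show "0 < gram_det (G K) x" if "x \<in> ref_triangle" for x
  proof -
    have "\<exists>a b. a \<in> verts K \<and> b \<in> verts K \<and> a \<noteq> b"
      using card_verts[OF K] unfolding numeral_3_eq_3 card_Suc_eq by blast
    then obtain a b where "a \<in> K" "b \<in> K" "a \<noteq> b" by (auto simp: verts_def extreme_point_of_def)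
    moreover have "bounded K"
    proof -
      have "bounded ((\<lambda>x. F K x - F K 0) ` ref_triangle)"
        using F_affine[OF K] compact_imp_bounded[OF compact_ref_triangle]
        by (intro bounded_linear_image) (simp_all add: linear_conv_bounded_linear)
      then have "bounded ((\<lambda>y. F K 0 + y) ` (\<lambda>x. F K x - F K 0) ` ref_triangle)"
        by (rule bounded_translation)
      then show ?thesis using F_bij[OF K] by (simp add: image_image bij_betw_def)
    qed
    ultimately have "0 < diameter K"
      using diameter_bounded_bound[of K a b] by (smt (verit) zero_less_dist_iff)
    then have "0 < diameter K ^ 4 / C" using C by simp
    also have "\<dots> \<le> gram_det (G K) x" using param that by (simp add: curved_param_def)
    finally show ?thesis .
  qed
qed

text \<open>
  Orientation conditions on the mesh are phrased with the derivative of \<open>\<Psi>\<close> on the flat element. On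
  tangent vectors it is determined by the derivative of the parametrization.
\<close>

lemma tangential_derivative_\<Psi>:
  assumes K: "K \<in> \<K>" and x: "x \<in> ref_triangle"
  shows "frechet_derivative \<Psi> (at (F K x) within K) (F K y - F K z) = D_ref (G K) x (y - z)"
proof -
  interpret curved_triangle "G K" "\<nu> K" k by (rule element[OF K])
  let ?D = "frechet_derivative \<Psi> (at (F K x) within K)"
  have FK: "F K x \<in> K" using F_bij[OF K] x by (auto simp: bij_betw_def)
  have "(\<lambda>y. \<Psi> y $ i) differentiable (at (F K x) within K)" for i
  proof -
    have "high_order_map C k \<Omega> \<T> \<Psi>"
      using surface by (simp add: high_order_surface_def Let_def)
    then have "\<forall>K\<in>\<K>. \<forall>i. \<exists>p\<in>poly_le k. \<forall>x\<in>K. \<Psi> x $ i = p x"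
      unfolding high_order_map_def \<K> by (elim conjE)
    then obtain p where p: "p \<in> poly_le k" "\<forall>y\<in>K. \<Psi> y $ i = p y"
      using K by blast
    show ?thesis
      by (rule differentiable_transform_within[OF poly_le_differentiable[OF p(1)] zero_less_one FK])
         (use p(2) in simp)
  qed
  then have "\<Psi> differentiable (at (F K x) within K)" by (rule differentiable_componentwise_vec)
  then have D: "(\<Psi> has_derivative ?D) (at (F K x) within K)"
    by (rule iffD1[OF frechet_derivative_works])
  let ?L = "\<lambda>y. F K y - F K 0"
  interpret L: linear ?L by (rule F_affine[OF K])
  have "bounded_linear ?L" using F_affine[OF K] by (simp add: linear_conv_bounded_linear)
  then have "(?L has_derivative ?L) (at x within ref_triangle)" by (rule bounded_linear_imp_has_derivative)
  from has_derivative_add[OF this has_derivative_const[of "F K 0"]]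
  have dF: "(F K has_derivative ?L) (at x within ref_triangle)" by simp
  have "(G K has_derivative (\<lambda>h. ?D (?L h))) (at x within ref_triangle)"
    using has_derivative_in_compose[OF dF, of \<Psi> ?D] D F_bij[OF K] by (simp add: bij_betw_def o_def)
  then have "D_ref (G K) x = (\<lambda>h. ?D (?L h))"
    by (rule ref_triangle_derivative_unique[OF x D_ref_works[OF x]])
  moreover have "?L (y - z) = F K y - F K z" using L.diff[of y z] by simp
  ultimately show ?thesis by simp
qed

definition coord where "coord K = the_inv_into ref_triangle (F K)"

lemma coord_verts:
  assumes K: "K \<in> \<K>"
  shows "inj_on (F K) ref_verts" "A \<in> verts K \<Longrightarrow> coord K A \<in> ref_verts" "A \<in> verts K \<Longrightarrow> F K (coord K A) = A"
    "a \<in> ref_verts \<Longrightarrow> coord K (F K a) = a" "ref_verts \<subseteq> ref_triangle"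
proof -
  show sub: "ref_verts \<subseteq> ref_triangle" by (simp add: ref_triangle_hull hull_subset)
  have inj: "inj_on (F K) ref_triangle" using F_bij[OF K] by (simp add: bij_betw_def)
  from inj sub show "inj_on (F K) ref_verts" by (rule inj_on_subset)
  show *: "coord K (F K a) = a" if "a \<in> ref_verts" for a
    unfolding coord_def by (rule the_inv_into_f_f[OF inj]) (use sub that in auto)
  show "A \<in> verts K \<Longrightarrow> coord K A \<in> ref_verts" "A \<in> verts K \<Longrightarrow> F K (coord K A) = A"
    unfolding verts_eq[OF K] by (auto simp: *)
qed

lemma edge_point:
  assumes K: "K \<in> \<K>" and AB: "A \<in> verts K" "B \<in> verts K" and s: "s \<in> {0..1}"
  defines "x \<equiv> coord K A + s *\<^sub>R (coord K B - coord K A)"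
  shows "x \<in> ref_triangle" "F K x = A + s *\<^sub>R (B - A)"
proof -
  have "coord K A \<in> ref_triangle" "coord K B \<in> ref_triangle" using coord_verts[OF K] AB by auto
  then show "x \<in> ref_triangle"
    using s convex_ref_triangle unfolding x_def convex_alt
    by (auto simp: algebra_simps) 
  interpret L: linear "\<lambda>y. F K y - F K 0" by (rule F_affine[OF K])
  have "F K x - F K 0 = (F K (coord K A) - F K 0)
      + s *\<^sub>R ((F K (coord K B) - F K 0) - (F K (coord K A) - F K 0))"
    unfolding x_def using L.add L.scale L.diff by metis
  then show "F K x = A + s *\<^sub>R (B - A)" using coord_verts(3)[OF K] AB by simp
qed

text \<open>
  The tangent vector of a curved edge depends on \<open>\<Psi>\<close> along the edge only, so it is the same for both
  elements that share the edge.
\<close>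

lemma edge_tangent:
  assumes K: "K \<in> \<K>" and AB: "A \<in> verts K" "B \<in> verts K" and s: "s \<in> {0..1}"
  shows "D_ref (G K) (coord K A + s *\<^sub>R (coord K B - coord K A)) (coord K B - coord K A)
    = vector_derivative (\<lambda>s. \<Psi> (A + s *\<^sub>R (B - A))) (at s within {0..1})"
proof -
  interpret curved_triangle "G K" "\<nu> K" k by (rule element[OF K])
  let ?c = "\<lambda>s. coord K A + s *\<^sub>R (coord K B - coord K A)"
  have sub: "?c ` {0..1} \<subseteq> ref_triangle" using edge_point(1)[OF K AB] by auto
  have "(?c has_derivative (\<lambda>h. h *\<^sub>R (coord K B - coord K A))) (at s within {0..1})"
    by (auto intro!: derivative_eq_intros)
  from has_derivative_in_compose[OF this has_derivative_subset[OF D_ref_works sub]]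
  have "((\<lambda>s. G K (?c s)) has_derivative (\<lambda>h. D_ref (G K) (?c s) (h *\<^sub>R (coord K B - coord K A)))) (at s within {0..1})"
    using edge_point(1)[OF K AB s] by simp
  then have "((\<lambda>s. G K (?c s)) has_vector_derivative D_ref (G K) (?c s) (coord K B - coord K A)) (at s within {0..1})"
    using linear.scaleR[OF has_derivative_linear[OF D_ref_works]] edge_point(1)[OF K AB s]
    by (simp add: has_vector_derivative_def linear_cmul)
  then have "((\<lambda>s. \<Psi> (A + s *\<^sub>R (B - A))) has_vector_derivative
      D_ref (G K) (?c s) (coord K B - coord K A)) (at s within {0..1})"
    by (rule has_vector_derivative_transform[OF s, rotated]) (simp add: edge_point(2)[OF K AB])
  from vector_derivative_within_closed_interval[OF zero_less_one s this] show ?thesis by (rule sym)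
qed

definition w :: "(real^3) set \<Rightarrow> real^2 \<Rightarrow> real^2" where
  "w K = (SOME w. (\<forall>i. (\<lambda>x. w x $ i) \<in> poly_le r) \<and> (\<forall>x\<in>\<Psi> ` K. v K x = piola (G K) w x))"

lemma w_poly: "K \<in> \<K> \<Longrightarrow> (\<lambda>x. w K x $ i) \<in> poly_le r"
  and v_eq: "K \<in> \<K> \<Longrightarrow> x \<in> \<Psi> ` K \<Longrightarrow> v K x = piola (G K) (w K) x"
proof -
  have w: "(\<forall>i. (\<lambda>x. w K x $ i) \<in> poly_le r) \<and> (\<forall>x\<in>\<Psi> ` K. v K x = piola (G K) (w K) x)" if K: "K \<in> \<K>"
  proof -
    have "v K \<in> local_V r (G K)" using v K by (simp add: V_h_def)
    then have "\<exists>w. (\<forall>i. (\<lambda>x. w x $ i) \<in> poly_le r) \<and> (\<forall>x\<in>\<Psi> ` K. v K x = piola (G K) w x)"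
      unfolding local_V_def G_image[OF K] by simp
    from someI_ex[OF this] show ?thesis unfolding w_def .
  qed
  show "K \<in> \<K> \<Longrightarrow> (\<lambda>x. w K x $ i) \<in> poly_le r"
    "K \<in> \<K> \<Longrightarrow> x \<in> \<Psi> ` K \<Longrightarrow> v K x = piola (G K) (w K) x"
    using w by blast+
qed

abbreviation sgn_of where "sgn_of K \<equiv> curved_triangle.\<sigma> (G K) (\<nu> K)"

text \<open>
  At a node the signed flux density is given by data of the edge and of the element selected at that
  node; the element \<open>K\<close> does not occur on the right-hand side.
\<close>

lemma nodal_flux:
  assumes K: "K \<in> \<K>" and AB: "A \<in> verts K" "B \<in> verts K" and s: "s \<in> {0..1}"
    and node: "A + s *\<^sub>R (B - A) \<in> N"
  defines "y \<equiv> \<Psi> (A + s *\<^sub>R (B - A))"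
  shows "sgn_of K * det2 (w K (coord K A + s *\<^sub>R (coord K B - coord K A))) (coord K B - coord K A)
    = - (cross3 (v (Ka y) y) (\<nu> (Ka y) y) \<bullet> vector_derivative (\<lambda>s. \<Psi> (A + s *\<^sub>R (B - A))) (at s within {0..1}))"
proof -
  interpret curved_triangle "G K" "\<nu> K" k by (rule element[OF K])
  define x where "x = coord K A + s *\<^sub>R (coord K B - coord K A)"
  let ?t = "D_ref (G K) x (coord K B - coord K A)"
  have x: "x \<in> ref_triangle" "G K x = y"
    using edge_point[OF K AB s] by (simp_all add: x_def y_def)
  then have yK: "y \<in> \<Psi> ` K" using G_image[OF K] by blast
  have "v K y = node_transfer (\<nu> (Ka y) y) (\<nu> K y) (v (Ka y) y)"
    using v node K yK unfolding V_h_def elements_at_def y_def by blast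
  then have "cross3 ?t (\<nu> K y) \<bullet> v K y = - (cross3 (v (Ka y) y) (\<nu> (Ka y) y) \<bullet> ?t)"
    using node_transfer_conormal[OF normal_unit[OF x(1)] normal_orthogonal[OF x(1)]]
    unfolding x(2) by (simp only:)
  moreover have "cross3 ?t (\<nu> K y) \<bullet> v K y = \<sigma> * det2 (w K x) (coord K B - coord K A)"
    using conormal_piola[OF x(1)] unfolding x(2) v_eq[OF K yK] .
  ultimately show ?thesis using edge_tangent[OF K AB s] by (simp add: x_def)
qed

text \<open>
  The flux densities are polynomials of degree at most \<open>r\<close> along the edge which agree at \<open>r + 1\<close> nodes,
  hence everywhere.
\<close>

lemma signed_flux_agrees:
  assumes K: "K \<in> \<K>" "A \<in> verts K" "B \<in> verts K" and K': "K' \<in> \<K>" "A \<in> verts K'" "B \<in> verts K'"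
    and AB: "A \<noteq> B"
  shows "sgn_of K * edge_flux (w K) (coord K A) (coord K B)
    = sgn_of K' * edge_flux (w K') (coord K' A) (coord K' B)"
proof -
  let ?f = "\<lambda>K s. det2 (w K (coord K A + s *\<^sub>R (coord K B - coord K A))) (coord K B - coord K A)"
  have poly: "\<exists>u. degree u \<le> r \<and> (\<forall>s. sgn_of K * ?f K s = poly u s)" if K: "K \<in> \<K>" for K
  proof -
    let ?t = "coord K B - coord K A"
    obtain u1 where u1: "degree u1 \<le> r" "\<And>s. w K (coord K A + s *\<^sub>R ?t) $ 1 = poly u1 s"
      using poly_le_on_line[OF w_poly[OF K]] by blast
    obtain u2 where u2: "degree u2 \<le> r" "\<And>s. w K (coord K A + s *\<^sub>R ?t) $ 2 = poly u2 s"
      using poly_le_on_line[OF w_poly[OF K]] by blast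
    let ?u = "smult (sgn_of K) (smult (?t $ 2) u1 - smult (?t $ 1) u2)"
    have "degree ?u \<le> r"
      by (rule order_trans[OF degree_smult_le degree_diff_le]) (use u1 u2 degree_smult_le order_trans in blast)+
    moreover have "sgn_of K * ?f K s = poly ?u s" for s
      unfolding det2_def u1 u2 by (simp add: algebra_simps)
    ultimately show ?thesis by blast
  qed
  obtain u where u: "degree u \<le> r" "\<And>s. sgn_of K * ?f K s = poly u s" using poly[OF K(1)] by blast
  obtain u' where u': "degree u' \<le> r" "\<And>s. sgn_of K' * ?f K' s = poly u' s" using poly[OF K'(1)] by blast
  obtain S where S: "finite S" "card S = Suc r" "S \<subseteq> gauss_lobatto r" "S \<subseteq> {-1..1}"
    using gauss_lobatto_points[OF r] .
  have "u = u'"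
  \<comment> \<open>the nodes are given on \<open>[-1,1]\<close>, edges are parametrized over \<open>[0,1]\<close>\<close>
  proof (rule poly_eqI_degree[where A="(\<lambda>s. (1 + s) / 2) ` S"])
    have "card ((\<lambda>s. (1 + s) / 2) ` S) = Suc r"
      using S(2) by (subst card_image) (auto simp: inj_on_def)
    then show "degree u < card ((\<lambda>s. (1 + s) / 2) ` S)" "degree u' < card ((\<lambda>s. (1 + s) / 2) ` S)"
      using u(1) u'(1) by simp_all
    fix s' assume "s' \<in> (\<lambda>s. (1 + s) / 2) ` S"
    then obtain s where s: "s \<in> S" "s' = (1 + s) / 2" by blast
    have s': "s' \<in> {0..1}" using s S(4) by auto
    have "A + s' *\<^sub>R (B - A) = (1 - s') *\<^sub>R A + s' *\<^sub>R B" by (simp add: algebra_simps)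
    moreover have "1 - s' = (1 - s) / 2" by (simp add: s(2) field_simps)
    ultimately have "A + s' *\<^sub>R (B - A) = ((1 - s) / 2) *\<^sub>R A + ((1 + s) / 2) *\<^sub>R B"
      using s(2) by (simp only:)
    moreover have "\<dots> \<in> edge_nodes r A B" using s S(3) by (auto simp: edge_nodes_def)
    moreover have "N \<inter> closed_segment A B = edge_nodes r A B"
      using nodes K AB unfolding lagrange_nodes_def by blast
    ultimately have "A + s' *\<^sub>R (B - A) \<in> N" by auto
    from nodal_flux[OF K s' this] nodal_flux[OF K' s' this]
    show "poly u s' = poly u' s'" unfolding u(2)[symmetric] u'(2)[symmetric] by (simp only:)
  qed
  then have eq: "sgn_of K * ?f K s = sgn_of K' * ?f K' s" for s by (simp only: u u')
  have "sgn_of K * edge_flux (w K) (coord K A) (coord K B) = integral {0..1} (\<lambda>s. sgn_of K * ?f K s)"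
    by (simp add: edge_flux_def)
  also have "\<dots> = sgn_of K' * edge_flux (w K') (coord K' A) (coord K' B)"
    unfolding eq by (simp add: edge_flux_def)
  finally show ?thesis .
qed

text \<open>
  By \<open>conormal_det2\<close> the quantity in the coherence condition is, up to the positive factor \<open>J\<close>, the negative
  of the orientation sign of the element times that of the edge on the reference triangle. It
  suffices to evaluate the condition at the midpoint \<open>m\<close> of the edge.
\<close>

lemma opposite_orientation:
  assumes K: "K \<in> \<K>" "A \<in> verts K" "B \<in> verts K" and K': "K' \<in> \<K>" "A \<in> verts K'" "B \<in> verts K'"
    and AB: "A \<noteq> B" and KK': "K \<noteq> K'"
  shows "(sgn_of K * orient (coord K A) (coord K B)) * (sgn_of K' * orient (coord K' A) (coord K' B)) < 0"
proof -
  define m where "m = A + (1/2) *\<^sub>R (B - A)"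
  let ?x = "\<lambda>K. coord K A + (1/2) *\<^sub>R (coord K B - coord K A)"
  let ?P = "\<lambda>K. F K (opposite (coord K A) (coord K B))"
  have side: "verts K = {A, B, ?P K}"
    "cross3 (frechet_derivative \<Psi> (at m within K) (B - A)) (\<nu> K (\<Psi> m))
        \<bullet> frechet_derivative \<Psi> (at m within K) (?P K - m)
      = - (sgn_of K * orient (coord K A) (coord K B)) * J (G K) (?x K)"
    "0 < J (G K) (?x K)"
    "frechet_derivative \<Psi> (at m within K) (B - A) = vector_derivative (\<lambda>s. \<Psi> (A + s *\<^sub>R (B - A))) (at (1/2) within {0..1})"
    if K: "K \<in> \<K>" "A \<in> verts K" "B \<in> verts K" for K
  proof -
    interpret curved_triangle "G K" "\<nu> K" k by (rule element[OF K(1)])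
    let ?a = "coord K A" and ?b = "coord K B"
    note c = coord_verts[OF K(1)]
    have ne: "?a \<noteq> ?b" using c(3) K AB by metis
    have V: "ref_verts = {?a, ?b, opposite ?a ?b}"
      by (rule opposite_in_ref_verts[OF c(2)[OF K(2)] c(2)[OF K(3)] ne])
    have "verts K = F K ` {?a, ?b, opposite ?a ?b}" unfolding V[symmetric] by (rule verts_eq[OF K(1)])
    then show "verts K = {A, B, ?P K}" using c(3) K by simp
    have h: "(1/2 :: real) \<in> {0..1}" by simp
    have x: "?x K \<in> ref_triangle" "F K (?x K) = m"
      using edge_point[OF K h] by (simp_all add: m_def)
    show "0 < J (G K) (?x K)" by (rule J_pos[OF x(1)])
    have t: "frechet_derivative \<Psi> (at m within K) (B - A) = D_ref (G K) (?x K) (?b - ?a)"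
      using tangential_derivative_\<Psi>[OF K(1) x(1), of ?b ?a] c(3) K x(2) by simp
    then show "frechet_derivative \<Psi> (at m within K) (B - A)
        = vector_derivative (\<lambda>s. \<Psi> (A + s *\<^sub>R (B - A))) (at (1/2) within {0..1})"
      using edge_tangent[OF K h] by simp
    have p: "frechet_derivative \<Psi> (at m within K) (?P K - m) = D_ref (G K) (?x K) (opposite ?a ?b - ?x K)"
      using tangential_derivative_\<Psi>[OF K(1) x(1), of "opposite ?a ?b" "?x K"] x(2) by simp
    have "det2 (opposite ?a ?b - ?x K) (?b - ?a) = - orient ?a ?b"
      by (simp add: det2_def orient_def field_simps)
    then show "cross3 (frechet_derivative \<Psi> (at m within K) (B - A)) (\<nu> K (\<Psi> m))
        \<bullet> frechet_derivative \<Psi> (at m within K) (?P K - m)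
      = - (sgn_of K * orient (coord K A) (coord K B)) * J (G K) (?x K)"
      using conormal_det2[OF x(1), of "?b - ?a" "opposite ?a ?b - ?x K"] x(2) by (simp add: t p)
  qed
  have "coherent_normal \<K> \<Psi> \<nu>"
    using surface by (simp add: high_order_surface_def outward_unit_normal_def \<K> Let_def)
  moreover have "m \<in> open_segment A B"
  proof -
    have "m = midpoint A B" by (simp add: m_def midpoint_def vec_eq_iff field_simps)
    then show ?thesis using AB by simp
  qed
  ultimately have "(cross3 (frechet_derivative \<Psi> (at m within K) (B - A)) (\<nu> K (\<Psi> m))
        \<bullet> frechet_derivative \<Psi> (at m within K) (?P K - m))
      * (cross3 (frechet_derivative \<Psi> (at m within K) (B - A)) (\<nu> K' (\<Psi> m))
        \<bullet> frechet_derivative \<Psi> (at m within K') (?P K' - m)) < 0"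
    using KK' AB K(1) K'(1) side(1)[OF K] side(1)[OF K'] unfolding coherent_normal_def Let_def by blast
  then have "(- (sgn_of K * orient (coord K A) (coord K B)) * J (G K) (?x K))
      * (- (sgn_of K' * orient (coord K' A) (coord K' B)) * J (G K') (?x K')) < 0"
    unfolding side(2)[OF K] side(2)[OF K', unfolded side(4)[OF K'] side(4)[OF K, symmetric]] .
  then have "((sgn_of K * orient (coord K A) (coord K B)) * (sgn_of K' * orient (coord K' A) (coord K' B)))
      * (J (G K) (?x K) * J (G K') (?x K')) < 0"
    by (simp add: mult_ac)
  moreover have "0 < J (G K) (?x K) * J (G K') (?x K')" using side(3)[OF K] side(3)[OF K'] by simp
  ultimately show ?thesis by (meson less_asym mult_less_0_iff)
qed

lemma sgn_of: "K \<in> \<K> \<Longrightarrow> sgn_of K = 1 \<or> sgn_of K = -1"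
  by (rule curved_triangle.sign[OF element])

lemma edge_fluxes_cancel:
  assumes K: "K \<in> \<K>" "A \<in> verts K" "B \<in> verts K" and K': "K' \<in> \<K>" "A \<in> verts K'" "B \<in> verts K'"
    and AB: "A \<noteq> B" and KK': "K \<noteq> K'"
  shows "orient (coord K A) (coord K B) * edge_flux (w K) (coord K A) (coord K B)
    + orient (coord K' A) (coord K' B) * edge_flux (w K') (coord K' A) (coord K' B) = 0"
proof -
  have o: "orient (coord K A) (coord K B) = 1 \<or> orient (coord K A) (coord K B) = -1"
    if "K \<in> \<K>" "A \<in> verts K" "B \<in> verts K" for K
    using orient_sign coord_verts(2,3)[OF that(1)] that AB by metis
  show ?thesis
    using signed_flux_agrees[OF K K' AB] opposite_orientation[OF K K' AB KK']
      sgn_of[OF K(1)] sgn_of[OF K'(1)] o[OF K] o[OF K'] by auto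
qed

lemma element_divergence:
  assumes K: "K \<in> \<K>"
  obtains d where "d \<in> poly_le (r - 1)"
    "\<And>x. x \<in> ref_triangle \<Longrightarrow> surf_div (\<Psi> ` K) (\<nu> K) (v K) (G K x) * J (G K) x = d x"
    "(LINT x:ref_triangle|lborel. d x) = (\<Sum>A\<in>verts K. \<Sum>B\<in>verts K - {A}.
      orient (coord K A) (coord K B) * edge_flux (w K) (coord K A) (coord K B)) / 2"
proof -
  let ?\<phi> = "\<lambda>A B. orient (coord K A) (coord K B) * edge_flux (w K) (coord K A) (coord K B)"
  obtain d1 d1' a b c where 1: "d1 \<in> poly_le (r - 1)" "d1' \<in> poly_le (r - 1)"
    "has_partials (\<lambda>x. w K x $ 1) d1 d1'" "has_partials d1 a b" "has_partials d1' b c"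
    using poly_le_partials[OF w_poly[OF K, of 1]] .
  obtain d2' d2 a b c where 2: "d2' \<in> poly_le (r - 1)" "d2 \<in> poly_le (r - 1)"
    "has_partials (\<lambda>x. w K x $ 2) d2' d2" "has_partials d2' a b" "has_partials d2 b c"
    using poly_le_partials[OF w_poly[OF K, of 2]] .
  note c = coord_verts[OF K]
  have "(\<Sum>A\<in>verts K. \<Sum>B\<in>verts K - {A}. ?\<phi> A B)
      = (\<Sum>a\<in>ref_verts. \<Sum>b\<in>ref_verts - {a}. ?\<phi> (F K a) (F K b))"
  proof -
    have "(\<Sum>B\<in>F K ` ref_verts - {F K a}. ?\<phi> (F K a) B)
        = (\<Sum>b\<in>ref_verts - {a}. ?\<phi> (F K a) (F K b))" if "a \<in> ref_verts" for a
    proof -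
      have "F K ` ref_verts - {F K a} = F K ` (ref_verts - {a})"
        using c(1) that by (auto simp: inj_on_def)
      moreover have "inj_on (F K) (ref_verts - {a})" using c(1) by (rule inj_on_diff)
      ultimately show ?thesis by (simp add: sum.reindex)
    qed
    then show ?thesis
      unfolding verts_eq[OF K] by (simp add: sum.reindex[OF c(1)])
  qed
  also have "\<dots> = (\<Sum>a\<in>ref_verts. \<Sum>b\<in>ref_verts - {a}. orient a b * edge_flux (w K) a b)"
    by (intro sum.cong refl) (simp add: c(4))
  also have "\<dots> = 2 * (LINT x:ref_triangle|lborel. d1 x + d2 x)"
    unfolding sum_edge_flux divergence_ref_triangle[OF 1(3) 2(3)
      has_partials_continuous[OF 1(4)] has_partials_continuous[OF 2(5)]] ..
  finally have int: "(LINT x:ref_triangle|lborel. d1 x + d2 x)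
      = (\<Sum>A\<in>verts K. \<Sum>B\<in>verts K - {A}. ?\<phi> A B) / 2" by simp
  show thesis
  proof (rule that[OF poly_le_add[OF 1(1) 2(2)] _ int])
    show "surf_div (\<Psi> ` K) (\<nu> K) (v K) (G K x) * J (G K) x = d1 x + d2 x"
      if x: "x \<in> ref_triangle" for x
      using curved_triangle.surf_div_piola[OF element[OF K] 1(3) 2(3) _ x, of "v K"] v_eq[OF K]
      unfolding G_image[OF K] by blast
  qed
qed

text \<open>
  The compatibility condition: with the reference divergences \<open>d\<close>, the discrete surface divergence has
  total integral zero.
\<close>

lemma divergence:
  obtains d where
    "\<And>K. K \<in> \<K> \<Longrightarrow> d K \<in> poly_le (r - 1)"
    "\<And>K x. K \<in> \<K> \<Longrightarrow> x \<in> ref_triangle \<Longrightarrow> surf_div (\<Psi> ` K) (\<nu> K) (v K) (G K x) * J (G K) x = d K x"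
    "(\<Sum>K\<in>\<K>. LINT x:ref_triangle|lborel. d K x) = 0"
proof -
  let ?\<phi> = "\<lambda>K A B. orient (coord K A) (coord K B) * edge_flux (w K) (coord K A) (coord K B)"
  have "\<forall>K\<in>\<K>. \<exists>d. d \<in> poly_le (r - 1)
      \<and> (\<forall>x\<in>ref_triangle. surf_div (\<Psi> ` K) (\<nu> K) (v K) (G K x) * J (G K) x = d x)
      \<and> (LINT x:ref_triangle|lborel. d x) = (\<Sum>A\<in>verts K. \<Sum>B\<in>verts K - {A}. ?\<phi> K A B) / 2"
    by (rule ballI, erule element_divergence) blast
  from bchoice[OF this] obtain d where d: "\<And>K. K \<in> \<K> \<Longrightarrow> d K \<in> poly_le (r - 1)"
    "\<And>K x. K \<in> \<K> \<Longrightarrow> x \<in> ref_triangle \<Longrightarrow> surf_div (\<Psi> ` K) (\<nu> K) (v K) (G K x) * J (G K) x = d K x"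
    "\<And>K. K \<in> \<K> \<Longrightarrow>
      (LINT x:ref_triangle|lborel. d K x) = (\<Sum>A\<in>verts K. \<Sum>B\<in>verts K - {A}. ?\<phi> K A B) / 2"
    by blast
  have "(\<Sum>K\<in>\<K>. LINT x:ref_triangle|lborel. d K x)
      = (\<Sum>K\<in>\<K>. \<Sum>A\<in>verts K. \<Sum>B\<in>verts K - {A}. ?\<phi> K A B) / 2"
    by (subst sum_divide_distrib) (rule sum.cong[OF refl d(3)])
  also have "(\<Sum>K\<in>\<K>. \<Sum>A\<in>verts K. \<Sum>B\<in>verts K - {A}. ?\<phi> K A B) = 0"
    by (rule sum_over_edges_cancel[OF closed, folded \<K>], rule edge_fluxes_cancel) simp_all
  finally show thesis using that[OF d(1,2)] by simp
qed

end

section \<open>Divergence-free discrete velocities\<close>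

theorem lemma3p4:
  fixes \<gamma> \<Omega> \<Omega>\<^sub>h N :: "(real^3) set"
    and \<delta> C :: real and k r :: nat
    and \<T> \<K> :: "(real^3) set set"
    and F :: "(real^3) set \<Rightarrow> real^2 \<Rightarrow> real^3"
    and \<Psi> :: "real^3 \<Rightarrow> real^3"
    and \<nu> v :: "(real^3) set \<Rightarrow> real^3 \<Rightarrow> real^3"
    and Ka :: "real^3 \<Rightarrow> (real^3) set"
  assumes "C > 0"
    and "exact_surface \<gamma> \<Omega> \<delta>"
    and "affine_mesh C \<gamma> \<Omega> \<delta> \<T>"
    and "\<K> = clough_tocher \<T>"
    and "high_order_surface C k \<Omega> \<T> F \<Psi> \<Omega>\<^sub>h \<nu>"
    and "r \<ge> 2"
    and "lagrange_nodes r \<K> N"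
    and "\<And>a. a \<in> \<Psi> ` N \<Longrightarrow> Ka a \<in> elements_at \<K> \<Psi> a"
    and "v \<in> V_h r \<K> F \<Psi> \<nu> N Ka"
    and "\<And>q. q \<in> Q_h r \<K> F \<Psi> \<Longrightarrow>
           (\<Sum>Kb\<in>\<K>. surf_integral (\<Psi> \<circ> F Kb) (\<lambda>x. surf_div (\<Psi> ` Kb) (\<nu> Kb) (v Kb) x * q Kb x)) = 0"
  shows "\<forall>Kb\<in>\<K>. \<forall>x\<in>\<Psi> ` Kb. surf_div (\<Psi> ` Kb) (\<nu> Kb) (v Kb) x = 0"
proof -
  have closed: "closed_polyhedral_surface \<T>" using assms(3) by (simp add: affine_mesh_def)
  interpret scott_vogelius_velocity C k r \<Omega> \<Omega>\<^sub>h N \<T> \<K> F \<Psi> \<nu> v Ka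
    by unfold_locales (use assms closed in simp_all)
  let ?T = ref_triangle
  obtain d where d: "\<And>K. K \<in> \<K> \<Longrightarrow> d K \<in> poly_le (r - 1)"
    "\<And>K x. K \<in> \<K> \<Longrightarrow> x \<in> ?T \<Longrightarrow> surf_div (\<Psi> ` K) (\<nu> K) (v K) (G K x) * J (G K) x = d K x"
    "(\<Sum>K\<in>\<K>. LINT x:?T|lborel. d K x) = 0"
    by (rule divergence) blast
  have cont: "continuous_on ?T (d K)" "continuous_on ?T (J (G K))" if "K \<in> \<K>" for K
    using poly_le_continuous[OF d(1)[OF that]] curved_triangle.continuous_J[OF element[OF that]] by auto
  have fin: "finite \<K>" using finite_clough_tocher[OF closed] by (simp add: \<K>)
  have inv: "the_inv_into ?T (G K) (G K x) = x" if "K \<in> \<K>" "x \<in> ?T" for K x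
    using curved_triangle.inj[OF element[OF that(1)]] that(2) by (rule the_inv_into_f_f)
  define area where "area = (\<Sum>K\<in>\<K>. LINT x:?T|lborel. J (G K) x)"
  have J0: "0 < J (G K) x" if "K \<in> \<K>" "x \<in> ?T" for K x
    using curved_triangle.J_pos[OF element] that .
  have "area \<noteq> 0"
  proof
    assume "area = 0"
    have nonneg: "0 \<le> (LINT x:?T|lborel. J (G K) x)" if "K \<in> \<K>" for K
      unfolding set_lebesgue_integral_def
      by (rule Bochner_Integration.integral_nonneg) (use J0[OF that] in \<open>auto simp: indicator_def less_imp_le\<close>)
    obtain T where "T \<in> \<T>" "2 simplex T" using closed by (auto simp: closed_polyhedral_surface_def)
    moreover from this have "verts T \<noteq> {}" using triangle_verts(1) by fastforce
    ultimately obtain K where K: "K \<in> \<K>" by (auto simp: \<K> clough_tocher_eq)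
    have "(LINT x:?T|lborel. J (G K) x) = 0"
      using \<open>area = 0\<close> sum_nonneg_eq_0_iff[of \<K> "\<lambda>K. LINT x:?T|lborel. J (G K) x", OF fin nonneg] K
      unfolding area_def by blast
    moreover have "0 \<in> ?T" by (simp add: ref_triangle_eq)
    ultimately have "J (G K) 0 = 0"
      using J0[OF K] by (intro ref_triangle_integral_eq_0[OF cont(2)[OF K]]) (auto intro: less_imp_le)
    then show False using J0[OF K \<open>0 \<in> ?T\<close>] by simp
  qed
  \<comment> \<open>the mean of the function whose pullbacks are the \<open>d K\<close>, so that \<open>q\<close> has mean zero\<close>
  define c where "c = (\<Sum>K\<in>\<K>. LINT x:?T|lborel. d K x * J (G K) x) / area"
  define q where "q K y = d K (the_inv_into ?T (G K) y) - c" for K y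
  have q: "q K (G K x) = d K x - c" if "K \<in> \<K>" "x \<in> ?T" for K x
    by (simp only: q_def inv[OF that])
  have qcont: "continuous_on ?T (\<lambda>x. q K (G K x))" if "K \<in> \<K>" for K
  proof -
    have "continuous_on ?T (\<lambda>x. d K x - c)" by (intro continuous_intros cont(1)[OF that])
    then show ?thesis by (rule continuous_on_eq) (simp add: q[OF that] del: o_apply)
  qed
  have "q \<in> Q_h r \<K> F \<Psi>"
  proof -
    have L2: "surf_L2 (G K) (q K)" if K: "K \<in> \<K>" for K
    proof -
      have "set_integrable lborel ?T (\<lambda>x. q K (G K x))"
        by (rule set_integrable_ref_triangle[OF qcont[OF K]])
      then have "set_borel_measurable lborel ?T (\<lambda>x. q K (G K x))"
        unfolding set_integrable_def set_borel_measurable_def by (rule borel_measurable_integrable)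
      moreover have "set_integrable lborel ?T (\<lambda>x. (norm (q K (G K x)))\<^sup>2 * J (G K) x)"
        by (intro set_integrable_ref_triangle continuous_intros qcont[OF K] cont(2)[OF K])
      ultimately show ?thesis by (simp add: surf_L2_def)
    qed
    have "q K \<in> local_Q r (G K)" if K: "K \<in> \<K>" for K
    proof -
      have "(\<lambda>x. d K x + (- c)) \<in> poly_le (r - 1)" by (rule poly_le_add[OF d(1)[OF K] poly_le_const])
      then show ?thesis unfolding local_Q_def by (intro CollectI bexI) (simp_all add: q_def)
    qed
    moreover have "(\<Sum>K\<in>\<K>. surf_integral (G K) (q K)) = 0"
    proof -
      have "surf_integral (G K) (q K)
          = (LINT x:?T|lborel. d K x * J (G K) x) - c * (LINT x:?T|lborel. J (G K) x)" if K: "K \<in> \<K>" for K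
      proof -
        have "surf_integral (G K) (q K) = (LINT x:?T|lborel. d K x * J (G K) x - c * J (G K) x)"
          unfolding surf_integral_def
          by (rule set_lebesgue_integral_cong)
             (use compact_imp_closed[OF compact_ref_triangle] in \<open>auto simp: q[OF K] left_diff_distrib simp del: o_apply\<close>)
        also have "\<dots> = (LINT x:?T|lborel. d K x * J (G K) x) - (LINT x:?T|lborel. c * J (G K) x)"
          by (intro set_integral_diff set_integrable_ref_triangle continuous_intros cont[OF K])
        finally show ?thesis by simp
      qed
      then have "(\<Sum>K\<in>\<K>. surf_integral (G K) (q K))
          = (\<Sum>K\<in>\<K>. (LINT x:?T|lborel. d K x * J (G K) x) - c * (LINT x:?T|lborel. J (G K) x))"
        by (intro sum.cong refl)
      also have "\<dots> = (\<Sum>K\<in>\<K>. LINT x:?T|lborel. d K x * J (G K) x) - c * area"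
        unfolding sum_subtractf area_def sum_distrib_left ..
      finally show ?thesis using \<open>area \<noteq> 0\<close> by (simp add: c_def)
    qed
    ultimately show ?thesis using L2 by (simp add: Q_h_def)
  qed
  from assms(10)[OF this]
  have "(\<Sum>K\<in>\<K>. surf_integral (G K) (\<lambda>x. surf_div (\<Psi> ` K) (\<nu> K) (v K) x * q K x)) = 0" .
  moreover have "surf_integral (G K) (\<lambda>x. surf_div (\<Psi> ` K) (\<nu> K) (v K) x * q K x)
      = (LINT x:?T|lborel. (d K x)\<^sup>2) - c * (LINT x:?T|lborel. d K x)" if K: "K \<in> \<K>" for K
  proof -
    have eq: "surf_div (\<Psi> ` K) (\<nu> K) (v K) (G K x) * q K (G K x) * J (G K) x = (d K x)\<^sup>2 - c * d K x"
      if x: "x \<in> ?T" for x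
      unfolding q[OF K x] d(2)[OF K x, symmetric] by (simp add: algebra_simps power2_eq_square)
    have "surf_integral (G K) (\<lambda>x. surf_div (\<Psi> ` K) (\<nu> K) (v K) x * q K x)
        = (LINT x:?T|lborel. (d K x)\<^sup>2 - c * d K x)"
      unfolding surf_integral_def
      by (rule set_lebesgue_integral_cong)
         (use compact_imp_closed[OF compact_ref_triangle] eq in \<open>auto simp del: o_apply\<close>)
    also have "\<dots> = (LINT x:?T|lborel. (d K x)\<^sup>2) - (LINT x:?T|lborel. c * d K x)"
      by (intro set_integral_diff set_integrable_ref_triangle continuous_intros cont[OF K])
    finally show ?thesis by simp
  qed
  ultimately have "(\<Sum>K\<in>\<K>. (LINT x:?T|lborel. (d K x)\<^sup>2) - c * (LINT x:?T|lborel. d K x)) = 0"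
    by (metis (no_types, lifting) sum.cong)
  \<comment> \<open>the term with \<open>c\<close> drops out by the compatibility condition\<close>
  then have zero: "(\<Sum>K\<in>\<K>. LINT x:?T|lborel. (d K x)\<^sup>2) = 0"
    by (simp add: sum_subtractf d(3) flip: sum_distrib_left)
  have "d K x = 0" if K: "K \<in> \<K>" and x: "x \<in> ?T" for K x
  proof -
    have "0 \<le> (LINT x:?T|lborel. (d K x)\<^sup>2)" for K
      unfolding set_lebesgue_integral_def by (rule Bochner_Integration.integral_nonneg) simp
    then have "(LINT x:?T|lborel. (d K x)\<^sup>2) = 0"
      using zero sum_nonneg_eq_0_iff[OF fin, of "\<lambda>K. LINT x:?T|lborel. (d K x)\<^sup>2"] K by blast
    then have "(d K x)\<^sup>2 = 0"
      using x by (intro ref_triangle_integral_eq_0[where f="\<lambda>x. (d K x)\<^sup>2"] continuous_intros cont(1)[OF K]) auto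
    then show ?thesis by simp
  qed
  then show ?thesis
  proof (intro ballI)
    fix K y assume K: "K \<in> \<K>" and "y \<in> \<Psi> ` K"
    then obtain x where x: "x \<in> ?T" "y = G K x" using G_image[OF K] by blast
    show "surf_div (\<Psi> ` K) (\<nu> K) (v K) y = 0"
      using d(2)[OF K x(1)] \<open>\<And>K x. K \<in> \<K> \<Longrightarrow> x \<in> ?T \<Longrightarrow> d K x = 0\<close>[OF K x(1)] J0[OF K x(1)]
      unfolding x(2) by simp
  qed
qed

end
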